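(* (1) Let $\Phi:H_n\to H_k$ be a unital trace-preserving linear map satisfying $\gamma(\Phi)=\|\Phi\|_{1\to2}^2$, and let $\Omega:H_m\to H_l$ be a completely positive linear map. Then \[ \|\Phi\otimes\Omega\|_{1\to2}=\|\Phi\|_{1\to2}\,\|\Omega\|_{1\to2}, \] and, if moreover $\Phi$ and $\Omega$ are quantum channels, $S_{\min,2}(\Phi\otimes\Omega)=S_{\min,2}(\Phi)+S_{\min,2}(\Omega)$. (2) For unital quantum channels $\Phi_i:H_{n_i}\to H_{k_i}$, $i=1,\dots,N$, each satisfying $\gamma(\Phi_i)=\|\Phi_i\|_{1\to2}^2$, \[ \left\|\bigotimes_{i=1}^N\Phi_i\right\|_{1\to2}=\prod_{i=1}^N\|\Phi_i\|_{1\to2}\qquad\text{and}\qquad S_{\min,2}\left(\bigotimes_{i=1}^N\Phi_i\right)=\sum_{i=1}^N S_{\min,2}(\Phi_i). \]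
   Context: $H_n$ is the real vector space of $n\times n$ Hermitian matrices with inner product ${\rm Tr}(XY)$, $H_{n,0}$ its traceless subspace, $H_{n,+,1}$ the density matrices. A quantum channel is a completely positive trace-preserving map; $\Phi:H_n\to H_k$ is unital if $\Phi(I_n/n)=I_k/k$. $\|\Phi\|_{1\to2}=\max_{0\neq\rho}\|\Phi(\rho)\|_2/\|\rho\|_1$ over nonzero Hermitian $\rho$. $S_2(\sigma)=-\log{\rm Tr}\,\sigma^2$ and $S_{\min,2}(\Phi)=\min_{\rho\in H_{n,+,1}}S_2(\Phi(\rho))$. For a unital trace-preserving $\Phi:H_n\to H_k$, fix an orthonormal basis $M_1,\dots,M_{n^2-1}$ of $H_{n,0}$, let $(A_\Phi)_{i,j}={\rm Tr}[\Phi(M_i)\Phi(M_j)]$ with largest eigenvalue $\|A_\Phi\|_\infty$ (basis independent), and set $\gamma(\Phi)=\frac1k+\left(1-\frac1n\right)\|A_\Phi\|_\infty$ if $n\ge k\|A_\Phi\|_\infty$ and $\gamma(\Phi)=\|A_\Phi\|_\infty$ otherwise. (The condition $\gamma(\Phi)=\|\Phi\|_{1\to2}^2$ is called $\mathcal C_{add}$ in the paper.) *)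

theory Defs
  imports Complex_Main "Jordan_Normal_Form.Schur_Decomposition"
    "HOL-Computational_Algebra.Polynomial"
begin

type_synonym cmap = "complex mat \<Rightarrow> complex mat"

definition mtrace :: "complex mat \<Rightarrow> complex" where
  "mtrace A = (\<Sum>i<dim_row A. A $$ (i,i))"

definition herm :: "nat \<Rightarrow> complex mat set" where
  "herm n = {A. A \<in> carrier_mat n n \<and> mat_adjoint A = A}"

definition herm0 :: "nat \<Rightarrow> complex mat set" where
  "herm0 n = {A \<in> herm n. mtrace A = 0}"

definition psd :: "nat \<Rightarrow> complex mat set" where
  "psd n = {A \<in> herm n. \<forall>v \<in> carrier_vec n.
              0 \<le> Re (\<Sum>i<n. cnj (v $ i) * (A *\<^sub>v v) $ i)}"

definition density :: "nat \<Rightarrow> complex mat set" where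
  "density n = {A \<in> psd n. mtrace A = 1}"

definition hs_norm :: "complex mat \<Rightarrow> real" where
  "hs_norm X = sqrt (\<Sum>i<dim_row X. \<Sum>j<dim_col X. (cmod (X $$ (i,j)))\<^sup>2)"

text \<open>Trace norm of a Hermitian matrix: sum of absolute values of its eigenvalues
  (counted with algebraic multiplicity).\<close>
definition tr_norm :: "complex mat \<Rightarrow> real" where
  "tr_norm A = sum_mset (image_mset cmod (proots (char_poly A)))"

text \<open>Real-linear map from H_n to H_k (values outside H_n are irrelevant).\<close>
definition lin_map :: "nat \<Rightarrow> nat \<Rightarrow> cmap \<Rightarrow> bool" where
  "lin_map n k \<Phi> \<longleftrightarrow> (\<forall>A\<in>herm n. \<Phi> A \<in> herm k) \<and>
     (\<forall>A\<in>herm n. \<forall>B\<in>herm n. \<forall>a b :: real.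
        \<Phi> (complex_of_real a \<cdot>\<^sub>m A + complex_of_real b \<cdot>\<^sub>m B)
          = complex_of_real a \<cdot>\<^sub>m \<Phi> A + complex_of_real b \<cdot>\<^sub>m \<Phi> B)"

definition trace_pres :: "nat \<Rightarrow> cmap \<Rightarrow> bool" where
  "trace_pres n \<Phi> \<longleftrightarrow> (\<forall>A\<in>herm n. mtrace (\<Phi> A) = mtrace A)"

definition unital :: "nat \<Rightarrow> nat \<Rightarrow> cmap \<Rightarrow> bool" where
  "unital n k \<Phi> \<longleftrightarrow>
     \<Phi> ((1 / of_nat n) \<cdot>\<^sub>m 1\<^sub>m n) = (1 / of_nat k) \<cdot>\<^sub>m 1\<^sub>m k"

text \<open>Complex-linear extension of a map on Hermitian matrices to all square matrices:
  X = H1 + i H2 with H1, H2 Hermitian.\<close>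
definition cext :: "cmap \<Rightarrow> cmap" where
  "cext \<Phi> X = \<Phi> ((1/2) \<cdot>\<^sub>m (X + mat_adjoint X))
               + \<i> \<cdot>\<^sub>m \<Phi> ((- \<i> / 2) \<cdot>\<^sub>m (X - mat_adjoint X))"

definition emat :: "nat \<Rightarrow> nat \<Rightarrow> nat \<Rightarrow> complex mat" where
  "emat n a b = mat n n (\<lambda>(i,j). if i = a \<and> j = b then 1 else 0)"

text \<open>Tensor product of Phi : H_n -> H_k and Omega : H_m -> H_l, as a map H_{nm} -> H_{kl}
  (Kronecker convention: index (a,c) of C^n (x) C^m is a*m+c), determined by
  (Phi (x) Omega)(E_ab (x) E_cd) = Phi_C(E_ab) (x) Omega_C(E_cd).\<close>
definition tensor_map :: "nat \<Rightarrow> nat \<Rightarrow> nat \<Rightarrow> nat \<Rightarrow> cmap \<Rightarrow> cmap \<Rightarrow> cmap" where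
  "tensor_map n k m l \<Phi> \<Omega> X = mat (k*l) (k*l) (\<lambda>(i,j).
     \<Sum>a<n. \<Sum>b<n. \<Sum>c<m. \<Sum>d<m. X $$ (a*m+c, b*m+d)
        * cext \<Phi> (emat n a b) $$ (i div l, j div l)
        * cext \<Omega> (emat m c d) $$ (i mod l, j mod l))"

definition cp :: "nat \<Rightarrow> nat \<Rightarrow> cmap \<Rightarrow> bool" where
  "cp m l \<Omega> \<longleftrightarrow> lin_map m l \<Omega> \<and>
     (\<forall>r. \<forall>X\<in>psd (r*m). tensor_map r r m l (\<lambda>Y. Y) \<Omega> X \<in> psd (r*l))"

definition channel :: "nat \<Rightarrow> nat \<Rightarrow> cmap \<Rightarrow> bool" where
  "channel n k \<Phi> \<longleftrightarrow> cp n k \<Phi> \<and> trace_pres n \<Phi>"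

definition norm12 :: "nat \<Rightarrow> cmap \<Rightarrow> real" where
  "norm12 n \<Phi> = (SUP \<rho>\<in>herm n - {0\<^sub>m n n}. hs_norm (\<Phi> \<rho>) / tr_norm \<rho>)"

definition S2 :: "complex mat \<Rightarrow> real" where
  "S2 \<sigma> = - ln (Re (mtrace (\<sigma> * \<sigma>)))"

definition Smin2 :: "nat \<Rightarrow> cmap \<Rightarrow> real" where
  "Smin2 n \<Phi> = (INF \<rho>\<in>density n. S2 (\<Phi> \<rho>))"

definition onb0 :: "nat \<Rightarrow> complex mat list \<Rightarrow> bool" where
  "onb0 n Ms \<longleftrightarrow> length Ms = n\<^sup>2 - 1 \<and> set Ms \<subseteq> herm0 n \<and>
     (\<forall>i<length Ms. \<forall>j<length Ms.
        mtrace (Ms ! i * Ms ! j) = (if i = j then 1 else 0))"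

definition A_mat :: "nat \<Rightarrow> cmap \<Rightarrow> real mat" where
  "A_mat n \<Phi> = (let Ms = (SOME Ms. onb0 n Ms) in
     mat (n\<^sup>2 - 1) (n\<^sup>2 - 1) (\<lambda>(i,j). Re (mtrace (\<Phi> (Ms ! i) * \<Phi> (Ms ! j)))))"

definition lam_max :: "real mat \<Rightarrow> real" where
  "lam_max A = (if dim_row A = 0 then 0 else Max {x. eigenvalue A x})"

definition gamma :: "nat \<Rightarrow> nat \<Rightarrow> cmap \<Rightarrow> real" where
  "gamma n k \<Phi> = (let a = lam_max (A_mat n \<Phi>) in
     if real n \<ge> real k * a then 1 / real k + (1 - 1 / real n) * a else a)"

primrec tens_iter :: "(nat \<Rightarrow> nat) \<Rightarrow> (nat \<Rightarrow> nat) \<Rightarrow> (nat \<Rightarrow> cmap) \<Rightarrow> nat \<Rightarrow> cmap" where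
  "tens_iter n k \<Phi> 0 = (\<lambda>X. X)"
| "tens_iter n k \<Phi> (Suc N) =
     tensor_map (\<Prod>i<N. n i) (\<Prod>i<N. k i) (n N) (k N) (tens_iter n k \<Phi> N) (\<Phi> N)"

end

(* A pure state psi on C^n (x) C^m is first acted on by id (x) Omega, giving a block matrix Y.
   A unital trace-preserving Phi satisfies
     |Phi(X)|^2 <= (1/k - lambda/n) |Tr X|^2 + lambda |X|^2,   lambda = the largest eigenvalue of A_Phi,
   because the identity component of X is mapped to the identity component of Phi(X). Summing this
   over the output indices of Omega bounds the output of Phi (x) Omega by |sum_a Y_aa| and |Y|.
   The Kraus form of Omega and Cauchy-Schwarz give |Y_ab|^2 <= |Y_aa| |Y_bb|, so both are at most
   sum_a |Y_aa| <= |Omega|, which yields gamma(Phi) |Omega|^2. Product states give the converse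
   inequality, and S_min,2 = -2 ln |.|_{1->2} for trace-preserving maps.
   Everything is computed with the entries K a b p q = (Phi E_ab)_pq of the complex extension. *)
theory Submission
  imports Defs "HOL-Analysis.L2_Norm"
begin

section \<open>The spectral theorem and the trace norm\<close>

lemma mult_carrier_square [simp]:
  assumes "A \<in> carrier_mat n n" "B \<in> carrier_mat n n"
  shows "A * B \<in> carrier_mat n n"
  using assms by (rule mult_carrier_mat)

lemma mat_adjoint_index [simp]:
  fixes A :: "complex mat"
  assumes "i < dim_col A" "j < dim_row A"
  shows "mat_adjoint A $$ (i,j) = cnj (A $$ (j,i))"
  using assms by (simp add: mat_adjoint_def mat_of_rows_def)

lemma mat_adjoint_dim [simp]:
  fixes A :: "complex mat"
  shows "dim_row (mat_adjoint A) = dim_col A" "dim_col (mat_adjoint A) = dim_row A"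
  by (simp_all add: mat_adjoint_def)

lemma mat_adjoint_carrier [simp]:
  fixes A :: "complex mat"
  shows "A \<in> carrier_mat n m \<Longrightarrow> mat_adjoint A \<in> carrier_mat m n"
  by (intro carrier_matI) simp_all

lemma mat_adjoint_mult:
  fixes A B :: "complex mat"
  assumes "A \<in> carrier_mat n m" "B \<in> carrier_mat m k"
  shows "mat_adjoint (A * B) = mat_adjoint B * mat_adjoint A"
  using assms by (intro eq_matI) (auto simp: scalar_prod_def mult.commute)

lemma index_mult_square:
  assumes "A \<in> carrier_mat n n" "B \<in> carrier_mat n n" "i < n" "j < n"
  shows "(A * B) $$ (i,j) = (\<Sum>k<n. A $$ (i,k) * B $$ (k,j))"
  using assms by (auto simp: scalar_prod_def lessThan_atLeast0)

lemma herm_carrier: "A \<in> herm n \<Longrightarrow> A \<in> carrier_mat n n"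
  by (simp add: herm_def)

lemma herm_cnj:
  assumes "A \<in> herm n" "i < n" "j < n"
  shows "cnj (A $$ (i,j)) = A $$ (j,i)"
proof -
  have "dim_row A = n" "dim_col A = n" and adj: "mat_adjoint A = A"
    using assms(1) by (auto simp: herm_def)
  then have "mat_adjoint A $$ (j,i) = cnj (A $$ (i,j))"
    using assms by (intro mat_adjoint_index) simp_all
  then show ?thesis unfolding adj by simp
qed

lemma hermI:
  assumes "A \<in> carrier_mat n n" "\<And>i j. i < n \<Longrightarrow> j < n \<Longrightarrow> cnj (A $$ (i,j)) = A $$ (j,i)"
  shows "A \<in> herm n"
  unfolding herm_def using assms by (auto intro!: eq_matI)

lemma sum_delta_mult:
  fixes f :: "nat \<Rightarrow> 'a::semiring_1"
  assumes "i < n"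
  shows "(\<Sum>k<n. (if i = k then 1 else 0) * f k) = f i"
    "(\<Sum>k<n. (if k = i then 1 else 0) * f k) = f i"
    "(\<Sum>k<n. f k * (if i = k then 1 else 0)) = f i"
    "(\<Sum>k<n. f k * (if k = i then 1 else 0)) = f i"
  using assms by (simp_all add: if_distrib[of "\<lambda>x. x * _"] if_distrib[of "\<lambda>x. _ * x"] cong: if_cong)

text \<open>The Householder reflection exchanging \<open>e\<^sub>0\<close> and \<open>v\<close>; for \<open>v = e\<^sub>0\<close> the factor
  \<open>2 / 0 = 0\<close> makes it the identity.\<close>

lemma householder:
  fixes v :: "nat \<Rightarrow> complex"
  assumes n: "0 < n" and unit: "(\<Sum>i<n. v i * cnj (v i)) = 1" and v0: "v 0 \<in> \<real>"
  obtains W :: "nat \<Rightarrow> nat \<Rightarrow> complex"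
  where "\<And>i j. cnj (W i j) = W j i"
    and "\<And>i j. i < n \<Longrightarrow> j < n \<Longrightarrow> (\<Sum>k<n. W i k * W k j) = (if i = j then 1 else 0)"
    and "\<And>i. i < n \<Longrightarrow> W i 0 = v i"
    and "(\<And>i. v i \<in> \<real>) \<Longrightarrow> (\<And>i j. W i j \<in> \<real>)"
proof -
  define w where "w i = (if i = 0 then 1 else 0) - v i" for i
  define s where "s = (\<Sum>i<n. w i * cnj (w i))"
  define W where "W i j = (if i = j then 1 else 0) - 2 / s * (w i * cnj (w j))" for i j
  have cv0: "cnj (v 0) = v 0" using v0 by (simp add: Reals_cnj_iff)
  have s_alt: "s = 2 * w 0"
  proof -
    have "s = (\<Sum>i<n. (if i = 0 then 1 - cnj (v i) - v i else 0) + v i * cnj (v i))"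
      unfolding s_def w_def by (intro sum.cong refl) (simp add: algebra_simps)
    also have "\<dots> = 2 - 2 * v 0" using n by (simp add: sum.distrib unit cv0)
    finally show ?thesis by (simp add: w_def)
  qed
  have s_real: "cnj s = s" unfolding s_def by (simp add: mult.commute)
  have w_zero: "w i = 0" if "s = 0" "i < n" for i
  proof -
    have "(\<Sum>i<n. (cmod (w i))\<^sup>2) = 0"
    proof -
      have "complex_of_real (\<Sum>i<n. (cmod (w i))\<^sup>2) = s"
        unfolding s_def of_real_sum by (intro sum.cong refl) (simp only: complex_norm_square)
      with that show ?thesis by (simp only: of_real_eq_0_iff)
    qed
    then show ?thesis using that by (simp add: sum_nonneg_eq_0_iff)
  qed
  show ?thesis
  proof
    show "cnj (W i j) = W j i" for i j
      unfolding W_def using s_real by (simp add: mult.commute)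
    show "(\<Sum>k<n. W i k * W k j) = (if i = j then 1 else 0)" if ij: "i < n" "j < n" for i j
    proof -
      let ?c = "2 / s"
      have "(\<Sum>k<n. W i k * W k j) =
         (\<Sum>k<n. (if i = k then 1 else 0) * (if k = j then 1 else 0)
           - ?c * w i * (cnj (w k) * (if k = j then 1 else 0))
           - ?c * cnj (w j) * ((if i = k then 1 else 0) * w k)
           + ?c^2 * (w i * cnj (w j)) * (w k * cnj (w k)))"
        unfolding W_def by (intro sum.cong refl) (simp only: power2_eq_square algebra_simps)
      also have "\<dots> = (if i = j then 1 else 0) - 2 * ?c * (w i * cnj (w j)) + ?c^2 * (w i * cnj (w j)) * s"
        unfolding sum.distrib sum_subtractf sum_distrib_left[symmetric] s_def[symmetric]
        using ij by (simp add: sum_delta_mult)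
      also have "\<dots> = (if i = j then 1 else 0)"
        by (cases "s = 0") (simp_all add: power2_eq_square field_simps)
      finally show ?thesis .
    qed
    show "W i 0 = v i" if "i < n" for i
    proof (cases "s = 0")
      case True
      then show ?thesis using w_zero[OF True that] by (simp add: W_def w_def)
    next
      case False
      have "cnj (w 0) = s / 2" using s_alt cv0 by (simp add: w_def)
      then have "W i 0 = (if i = 0 then 1 else 0) - w i"
        using False by (simp add: W_def field_simps)
      then show ?thesis by (simp add: w_def)
    qed
    show "W i j \<in> \<real>" if "\<And>i. v i \<in> \<real>" for i j
    proof -
      have "w i \<in> \<real>" for i unfolding w_def using that by auto
      moreover have "s \<in> \<real>" using s_real by (simp add: Reals_cnj_iff)
      ultimately show ?thesis unfolding W_def
        by (auto intro!: Reals_diff Reals_mult Reals_divide simp: Reals_cnj_iff)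
    qed
  qed
qed

lemma exists_unit_eigenvector:
  fixes A :: "complex mat"
  assumes A: "A \<in> carrier_mat n n" and n: "0 < n"
  obtains v e where "\<And>i. i < n \<Longrightarrow> (\<Sum>j<n. A $$ (i,j) * v j) = e * v i"
    "(\<Sum>i<n. v i * cnj (v i)) = 1" "v 0 \<in> \<real>"
proof -
  have "degree (char_poly A) = n" using degree_monic_char_poly[OF A] by simp
  then have "\<not> constant (poly (char_poly A))" using n by (simp add: constant_degree)
  then obtain e where "poly (char_poly A) e = 0"
    using fundamental_theorem_of_algebra by blast
  then have "eigenvalue A e" using eigenvalue_root_char_poly[OF A] by simp
  then obtain x where x: "x \<in> carrier_vec n" "x \<noteq> 0\<^sub>v n" "A *\<^sub>v x = e \<cdot>\<^sub>v x"
    unfolding eigenvalue_def eigenvector_def using A by auto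
  define r where "r = sqrt (\<Sum>i<n. (cmod (x $ i))\<^sup>2)"
  have "(\<Sum>i<n. (cmod (x $ i))\<^sup>2) \<noteq> 0"
  proof
    assume "(\<Sum>i<n. (cmod (x $ i))\<^sup>2) = 0"
    then have "\<forall>i<n. x $ i = 0" by (simp add: sum_nonneg_eq_0_iff)
    then have "x = 0\<^sub>v n" using x(1) by (intro eq_vecI) auto
    then show False using x by simp
  qed
  moreover have nn: "(\<Sum>i<n. (cmod (x $ i))\<^sup>2) \<ge> 0" by (simp add: sum_nonneg)
  ultimately have r: "r > 0" unfolding r_def by (simp add: less_le)
  have r2: "r\<^sup>2 = (\<Sum>i<n. (cmod (x $ i))\<^sup>2)" unfolding r_def using nn by simp
  define c where "c = (if x $ 0 = 0 then 1 else cnj (x $ 0) / cmod (x $ 0))"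
  have c1: "c * cnj c = 1"
    unfolding complex_norm_square[symmetric] c_def by (simp add: norm_divide)
  define v where "v i = c / r * x $ i" for i
  show ?thesis
  proof
    show "(\<Sum>j<n. A $$ (i,j) * v j) = e * v i" if "i < n" for i
    proof -
      have "(A *\<^sub>v x) $ i = (\<Sum>j<n. A $$ (i,j) * x $ j)"
        using that A x(1) by (auto simp: scalar_prod_def lessThan_atLeast0 intro!: sum.cong)
      then have "(\<Sum>j<n. A $$ (i,j) * x $ j) = e * x $ i" using x that by simp
      moreover have "(\<Sum>j<n. A $$ (i,j) * v j) = c / r * (\<Sum>j<n. A $$ (i,j) * x $ j)"
        unfolding v_def sum_distrib_left by (intro sum.cong refl) (simp add: ac_simps)
      ultimately show ?thesis by (simp add: v_def ac_simps)
    qed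
    have "(\<Sum>i<n. v i * cnj (v i)) = (c * cnj c) / (complex_of_real r)\<^sup>2 * (\<Sum>i<n. x $ i * cnj (x $ i))"
      unfolding v_def sum_distrib_left
      by (intro sum.cong refl) (simp add: power2_eq_square)
    also have "(\<Sum>i<n. x $ i * cnj (x $ i)) = complex_of_real (r\<^sup>2)"
      unfolding r2 of_real_sum by (intro sum.cong refl) (simp only: complex_norm_square)
    finally show "(\<Sum>i<n. v i * cnj (v i)) = 1" using r c1 by (simp add: power_divide)
    show "v 0 \<in> \<real>"
      unfolding v_def c_def
      by (simp add: Reals_cnj_iff mult.commute)
  qed
qed

definition spectral_dec :: "nat \<Rightarrow> complex mat \<Rightarrow> complex mat \<Rightarrow> (nat \<Rightarrow> real) \<Rightarrow> bool" where
  "spectral_dec n A U ev \<longleftrightarrow> U \<in> carrier_mat n n \<and> mat_adjoint U * U = 1\<^sub>m n \<and>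
     A = U * mat n n (\<lambda>(i,j). if i = j then complex_of_real (ev i) else 0) * mat_adjoint U"

lemma hermitian_deflate:
  assumes A: "A \<in> herm (Suc n)"
  obtains W B e where "W \<in> carrier_mat (Suc n) (Suc n)" "mat_adjoint W * W = 1\<^sub>m (Suc n)"
    "B \<in> herm n" "A = W * mat (Suc n) (Suc n) (\<lambda>(i,j). if i = 0 \<and> j = 0 then complex_of_real e
       else if i = 0 \<or> j = 0 then 0 else B $$ (i - 1, j - 1)) * mat_adjoint W"
proof -
  let ?n = "Suc n"
  have Ac: "A \<in> carrier_mat ?n ?n" using A by (rule herm_carrier)
  obtain v e where ev: "\<And>i. i < ?n \<Longrightarrow> (\<Sum>j<?n. A $$ (i,j) * v j) = e * v i"
    and un: "(\<Sum>i<?n. v i * cnj (v i)) = 1" and v0: "v 0 \<in> \<real>"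
    using exists_unit_eigenvector[OF Ac zero_less_Suc] by blast
  obtain Wf where Wh: "\<And>i j. cnj (Wf i j) = Wf j i"
    and Wu: "\<And>i j. i < ?n \<Longrightarrow> j < ?n \<Longrightarrow> (\<Sum>k<?n. Wf i k * Wf k j) = (if i = j then 1 else 0)"
    and Wv: "\<And>i. i < ?n \<Longrightarrow> Wf i 0 = v i"
    by (rule householder[OF zero_less_Suc un v0]) blast
  define W where "W = mat ?n ?n (\<lambda>(i,j). Wf i j)"
  have Wc: "W \<in> carrier_mat ?n ?n" by (simp add: W_def)
  have Wadj: "mat_adjoint W = W" by (intro eq_matI) (auto simp: W_def Wh)
  have WW: "W * W = 1\<^sub>m ?n"
    by (intro eq_matI) (auto simp: W_def scalar_prod_def lessThan_atLeast0[symmetric] Wu simp del: sum.lessThan_Suc)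
  define C where "C = W * A * W"
  have Cc: "C \<in> carrier_mat ?n ?n" unfolding C_def using Wc Ac by simp
  have AdA: "mat_adjoint A = A" using A by (simp add: herm_def)
  have Cadj: "mat_adjoint C = C"
    unfolding C_def using Wc Ac Wadj AdA
    by (simp add: mat_adjoint_mult[of _ ?n ?n _ ?n] assoc_mult_mat[of _ ?n ?n _ ?n _ ?n])
  then have Ch: "C \<in> herm ?n" using Cc by (simp add: herm_def)
  have AWC: "A = W * C * W"
  proof -
    have "W * C * W = (W * W) * A * (W * W)"
      unfolding C_def using Wc Ac by (simp add: assoc_mult_mat[of _ ?n ?n _ ?n _ ?n])
    then show ?thesis using WW Ac by simp
  qed
  have C0: "C $$ (i,0) = (if i = 0 then e else 0)" if i: "i < ?n" for i
  proof -
    have AW: "(A * W) $$ (k,0) = e * v k" if "k < ?n" for k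
    proof -
      have "(A * W) $$ (k,0) = (\<Sum>j<?n. A $$ (k,j) * W $$ (j,0))"
        using that by (intro index_mult_square[OF Ac Wc]) auto
      also have "\<dots> = (\<Sum>j<?n. A $$ (k,j) * v j)"
        by (intro sum.cong refl) (simp add: W_def Wv)
      finally show ?thesis using ev[OF that] by simp
    qed
    have "C = W * (A * W)" unfolding C_def using Wc Ac by (simp add: assoc_mult_mat[of _ ?n ?n _ ?n _ ?n])
    then have "C $$ (i,0) = (\<Sum>k<?n. W $$ (i,k) * (A * W) $$ (k,0))"
      using index_mult_square[OF Wc mult_carrier_square[OF Ac Wc] i zero_less_Suc] by simp
    also have "\<dots> = (\<Sum>k<?n. e * (Wf i k * Wf k 0))"
      using i AW Wv by (intro sum.cong refl) (simp add: W_def)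
    also have "\<dots> = e * (if i = 0 then 1 else 0)"
      unfolding sum_distrib_left[symmetric] using Wu[OF i zero_less_Suc] by simp
    finally show ?thesis by simp
  qed
  have C0': "C $$ (0,i) = (if i = 0 then e else 0)" if i: "i < ?n" for i
    using herm_cnj[OF Ch i zero_less_Suc] herm_cnj[OF Ch zero_less_Suc zero_less_Suc] C0[OF i] C0[of 0]
    by (auto split: if_splits)
  have er: "e = complex_of_real (Re e)"
    using herm_cnj[OF Ch zero_less_Suc zero_less_Suc] C0[of 0] by (simp add: complex_eq_iff)
  define B where "B = mat n n (\<lambda>(i,j). C $$ (Suc i, Suc j))"
  have "B \<in> herm n" unfolding B_def using herm_cnj[OF Ch] by (intro hermI) auto
  moreover have CE: "C = mat ?n ?n (\<lambda>(i,j). if i = 0 \<and> j = 0 then complex_of_real (Re e)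
       else if i = 0 \<or> j = 0 then 0 else B $$ (i - 1, j - 1))"
    using Cc C0 C0' er by (intro eq_matI) (auto simp: B_def)
  moreover have "A = W * C * mat_adjoint W" using AWC Wadj by simp
  ultimately show ?thesis using Wc WW Wadj by (intro that[of W B "Re e"]) simp_all
qed

lemma spectral_theorem:
  assumes "A \<in> herm n"
  obtains U ev where "spectral_dec n A U ev"
  using assms
proof (induction n arbitrary: A thesis)
  case 0
  have "spectral_dec 0 A (1\<^sub>m 0) (\<lambda>_. 0)"
    using herm_carrier[OF 0(2)] unfolding spectral_dec_def by (auto intro!: eq_matI)
  then show ?case by (rule 0(1))
next
  case (Suc n)
  let ?n = "Suc n"
  let ?E = "\<lambda>e B. mat ?n ?n (\<lambda>(i,j). if i = 0 \<and> j = 0 then e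
       else if i = 0 \<or> j = 0 then (0::complex) else B $$ (i - 1, j - 1))"
  obtain W B e where W: "W \<in> carrier_mat ?n ?n" "mat_adjoint W * W = 1\<^sub>m ?n"
    and B: "B \<in> herm n" and A: "A = W * ?E (complex_of_real e) B * mat_adjoint W"
    using hermitian_deflate[OF Suc(3)] by blast
  obtain U ev where U: "U \<in> carrier_mat n n" "mat_adjoint U * U = 1\<^sub>m n"
    and BU: "B = U * mat n n (\<lambda>(i,j). if i = j then complex_of_real (ev i) else 0) * mat_adjoint U"
    using Suc(1)[OF _ B] unfolding spectral_dec_def by blast
  define V where "V = ?E 1 U"
  define ev' where "ev' i = (if i = 0 then e else ev (i - 1))" for i
  let ?D = "mat n n (\<lambda>(i,j). if i = j then complex_of_real (ev i) else 0)"
  let ?D' = "mat ?n ?n (\<lambda>(i,j). if i = j then complex_of_real (ev' i) else 0)"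
  have Emult: "?E x X * ?E y Y = ?E (x * y) (X * Y)"
    if "X \<in> carrier_mat n n" "Y \<in> carrier_mat n n" for x y X Y
    using that
    by (intro eq_matI) (auto simp: scalar_prod_def sum.atLeast0_lessThan_Suc_shift simp del: sum.op_ivl_Suc)
  have Eadj: "mat_adjoint (?E x X) = ?E (cnj x) (mat_adjoint X)"
    if "X \<in> carrier_mat n n" for x X
    using that by (intro eq_matI) auto
  have D': "?D' = ?E (complex_of_real e) ?D"
    by (intro eq_matI) (auto simp: ev'_def)
  have V: "V \<in> carrier_mat ?n ?n" by (simp add: V_def)
  have VV: "mat_adjoint V * V = 1\<^sub>m ?n"
    unfolding V_def Eadj[OF U(1)] Emult[OF mat_adjoint_carrier[OF U(1)] U(1)] U(2)
    by (intro eq_matI) auto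
  have EB: "?E (complex_of_real e) B = V * ?D' * mat_adjoint V"
    unfolding D' V_def Eadj[OF U(1)] using U(1)
    by (subst Emult, simp, simp, subst Emult, simp, simp) (simp only: BU[symmetric] mult_1 mult_1_right complex_cnj_one)
  have "spectral_dec ?n A (W * V) ev'"
    unfolding spectral_dec_def
  proof (intro conjI)
    show "W * V \<in> carrier_mat ?n ?n" using W V by simp
    have "mat_adjoint (W * V) * (W * V) = mat_adjoint V * (mat_adjoint W * W) * V"
      using W(1) V
      by (simp add: mat_adjoint_mult[of _ ?n ?n _ ?n] assoc_mult_mat[of _ ?n ?n _ ?n _ ?n])
    then show "mat_adjoint (W * V) * (W * V) = 1\<^sub>m ?n"
      using W V VV by simp
    have "?D' \<in> carrier_mat ?n ?n" by simp
    then show "A = W * V * ?D' * mat_adjoint (W * V)"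
      unfolding A EB using W(1) V
      by (simp add: mat_adjoint_mult[of _ ?n ?n _ ?n] assoc_mult_mat[of _ ?n ?n _ ?n _ ?n])
  qed
  then show ?case by (rule Suc(2))
qed

lemma spectral_dec_adjoint_right:
  assumes "spectral_dec n A U ev"
  shows "U * mat_adjoint U = 1\<^sub>m n"
  using assms unfolding spectral_dec_def
  by (auto intro: mat_mult_left_right_inverse)

lemma spectral_dec_index:
  assumes S: "spectral_dec n A U ev" and ij: "i < n" "j < n"
  shows "A $$ (i,j) = (\<Sum>k<n. complex_of_real (ev k) * U $$ (i,k) * cnj (U $$ (j,k)))"
proof -
  let ?D = "mat n n (\<lambda>(i,j). if i = j then complex_of_real (ev i) else 0)"
  have U: "U \<in> carrier_mat n n" and A: "A = U * ?D * mat_adjoint U"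
    using S by (auto simp: spectral_dec_def)
  have D: "?D \<in> carrier_mat n n" by simp
  have UD: "(U * ?D) $$ (i,k) = U $$ (i,k) * ev k" if "k < n" for k
  proof -
    have "(U * ?D) $$ (i,k) = (\<Sum>l<n. U $$ (i,l) * ?D $$ (l,k))"
      by (rule index_mult_square[OF U D ij(1) that])
    also have "\<dots> = (\<Sum>l<n. if l = k then U $$ (i,k) * ev k else 0)"
      using that by (intro sum.cong refl) auto
    finally show ?thesis using that by simp
  qed
  have "A $$ (i,j) = (\<Sum>k<n. (U * ?D) $$ (i,k) * mat_adjoint U $$ (k,j))"
    unfolding A using U by (intro index_mult_square ij) auto
  also have "\<dots> = (\<Sum>k<n. complex_of_real (ev k) * U $$ (i,k) * cnj (U $$ (j,k)))"
    using U ij by (intro sum.cong refl) (simp add: UD mult.commute del: index_mult_mat)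
  finally show ?thesis .
qed

lemma spectral_dec_orthonormal_cols:
  assumes S: "spectral_dec n A U ev" and ij: "i < n" "j < n"
  shows "(\<Sum>k<n. cnj (U $$ (k,i)) * U $$ (k,j)) = (if i = j then 1 else 0)"
proof -
  have U: "U \<in> carrier_mat n n" and UU: "mat_adjoint U * U = 1\<^sub>m n"
    using S by (auto simp: spectral_dec_def)
  have "(mat_adjoint U * U) $$ (i,j) = (\<Sum>k<n. mat_adjoint U $$ (i,k) * U $$ (k,j))"
    using U by (intro index_mult_square ij) auto
  also have "\<dots> = (\<Sum>k<n. cnj (U $$ (k,i)) * U $$ (k,j))"
    using U ij by (intro sum.cong refl) auto
  finally show ?thesis using UU ij by simp
qed

lemma spectral_dec_orthonormal_rows:
  assumes S: "spectral_dec n A U ev" and ij: "i < n" "j < n"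
  shows "(\<Sum>k<n. U $$ (i,k) * cnj (U $$ (j,k))) = (if i = j then 1 else 0)"
proof -
  have U: "U \<in> carrier_mat n n" using S by (auto simp: spectral_dec_def)
  have "(U * mat_adjoint U) $$ (i,j) = (\<Sum>k<n. U $$ (i,k) * mat_adjoint U $$ (k,j))"
    using U by (intro index_mult_square ij) auto
  also have "\<dots> = (\<Sum>k<n. U $$ (i,k) * cnj (U $$ (j,k)))"
    using U ij by (intro sum.cong refl) auto
  finally show ?thesis using spectral_dec_adjoint_right[OF S] ij by simp
qed

lemma spectral_dec_char_poly:
  assumes S: "spectral_dec n A U ev"
  shows "char_poly A = (\<Prod>i<n. [:- complex_of_real (ev i), 1:])"
proof -
  let ?D = "mat n n (\<lambda>(i,j). if i = j then complex_of_real (ev i) else 0)"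
  have U: "U \<in> carrier_mat n n" and UU: "mat_adjoint U * U = 1\<^sub>m n"
    and A: "A = U * ?D * mat_adjoint U"
    using S by (auto simp: spectral_dec_def)
  have D: "?D \<in> carrier_mat n n" by simp
  have "A \<in> carrier_mat n n" unfolding A using U D by simp
  then have "similar_mat_wit A ?D U (mat_adjoint U)"
    using U UU spectral_dec_adjoint_right[OF S] A D by (intro similar_mat_witI[of _ _ n]) auto
  then have "similar_mat A ?D" by (auto simp: similar_mat_def)
  then have "char_poly A = char_poly ?D" by (rule char_poly_similar)
  also have "\<dots> = (\<Prod>a\<leftarrow>diag_mat ?D. [:- a, 1:])"
    by (rule char_poly_upper_triangular[OF D]) auto
  also have "diag_mat ?D = map (\<lambda>i. complex_of_real (ev i)) [0..<n]"
    by (simp add: diag_mat_def)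
  also have "(\<Prod>a\<leftarrow>map (\<lambda>i. complex_of_real (ev i)) [0..<n]. [:- a, 1:])
      = (\<Prod>i<n. [:- complex_of_real (ev i), 1:])"
    using prod.distinct_set_conv_list[of "[0..<n]" "\<lambda>i. [:- complex_of_real (ev i), 1:]"]
    by (simp add: lessThan_atLeast0 o_def)
  finally show ?thesis .
qed

lemma tr_norm_spectral:
  assumes "spectral_dec n A U ev"
  shows "tr_norm A = (\<Sum>i<n. \<bar>ev i\<bar>)"
proof -
  have "proots (char_poly A) = (\<Sum>i<n. {#complex_of_real (ev i)#})"
    unfolding spectral_dec_char_poly[OF assms] by (subst proots_prod) (auto simp del: prod_constant)
  moreover have "sum_mset (image_mset cmod (\<Sum>i<m. {#complex_of_real (ev i)#})) = (\<Sum>i<m. \<bar>ev i\<bar>)" for m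
    by (induction m) auto
  ultimately show ?thesis by (simp add: tr_norm_def)
qed

section \<open>Matrix entries of linear maps and tensor products\<close>

definition kern :: "nat \<Rightarrow> cmap \<Rightarrow> nat \<Rightarrow> nat \<Rightarrow> nat \<Rightarrow> nat \<Rightarrow> complex" where
  "kern n \<Phi> a b p q = cext \<Phi> (emat n a b) $$ (p,q)"

definition kmap :: "nat \<Rightarrow> nat \<Rightarrow> (nat \<Rightarrow> nat \<Rightarrow> nat \<Rightarrow> nat \<Rightarrow> complex) \<Rightarrow> cmap" where
  "kmap n k K X = mat k k (\<lambda>(p,q). \<Sum>a<n. \<Sum>b<n. X $$ (a,b) * K a b p q)"

definition hre :: "complex mat \<Rightarrow> complex mat" where
  "hre X = (1/2) \<cdot>\<^sub>m (X + mat_adjoint X)"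

definition him :: "complex mat \<Rightarrow> complex mat" where
  "him X = (- \<i> / 2) \<cdot>\<^sub>m (X - mat_adjoint X)"

lemma cext_alt: "cext \<Phi> X = \<Phi> (hre X) + \<i> \<cdot>\<^sub>m \<Phi> (him X)"
  by (simp add: cext_def hre_def him_def)

lemma hre_carrier [simp]: "X \<in> carrier_mat n n \<Longrightarrow> hre X \<in> carrier_mat n n"
  and him_carrier [simp]: "X \<in> carrier_mat n n \<Longrightarrow> him X \<in> carrier_mat n n"
  by (simp_all add: hre_def him_def minus_carrier_mat)

lemma hre_dim [simp]: "dim_row (hre X) = dim_col X" "dim_col (hre X) = dim_row X"
  and him_dim [simp]: "dim_row (him X) = dim_col X" "dim_col (him X) = dim_row X"
  by (simp_all add: hre_def him_def)

lemma hre_index: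
  "X \<in> carrier_mat n n \<Longrightarrow> i < n \<Longrightarrow> j < n \<Longrightarrow> hre X $$ (i,j) = (X $$ (i,j) + cnj (X $$ (j,i))) / 2"
  by (auto simp: hre_def)

lemma him_index:
  "X \<in> carrier_mat n n \<Longrightarrow> i < n \<Longrightarrow> j < n \<Longrightarrow> him X $$ (i,j) = - \<i> / 2 * (X $$ (i,j) - cnj (X $$ (j,i)))"
  by (auto simp: him_def)

lemma hre_herm: "X \<in> carrier_mat n n \<Longrightarrow> hre X \<in> herm n"
  by (intro hermI) (auto simp: hre_index)

lemma him_herm: "X \<in> carrier_mat n n \<Longrightarrow> him X \<in> herm n"
  by (intro hermI) (auto simp: him_index field_simps)

lemma hre_him: "X \<in> carrier_mat n n \<Longrightarrow> i < n \<Longrightarrow> j < n \<Longrightarrow> X $$ (i,j) = hre X $$ (i,j) + \<i> * him X $$ (i,j)"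
  by (simp add: hre_index him_index field_simps)

lemma herm_lincomb:
  assumes "A \<in> herm n" "B \<in> herm n"
  shows "complex_of_real a \<cdot>\<^sub>m A + complex_of_real b \<cdot>\<^sub>m B \<in> herm n"
  using assms herm_carrier[OF assms(1)] herm_carrier[OF assms(2)]
  by (intro hermI) (auto simp: herm_cnj)

lemma lin_map_herm: "lin_map n k \<Phi> \<Longrightarrow> A \<in> herm n \<Longrightarrow> \<Phi> A \<in> herm k"
  by (simp add: lin_map_def)

lemma lin_map_carrier: "lin_map n k \<Phi> \<Longrightarrow> A \<in> herm n \<Longrightarrow> \<Phi> A \<in> carrier_mat k k"
  by (simp add: lin_map_def herm_carrier)

lemma lin_map_lincomb_index:
  assumes "lin_map n k \<Phi>" "A \<in> herm n" "B \<in> herm n" "p < k" "q < k"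
    and X: "X = complex_of_real a \<cdot>\<^sub>m A + complex_of_real b \<cdot>\<^sub>m B"
  shows "\<Phi> X $$ (p,q) = a * \<Phi> A $$ (p,q) + b * \<Phi> B $$ (p,q)"
proof -
  have "\<Phi> X = complex_of_real a \<cdot>\<^sub>m \<Phi> A + complex_of_real b \<cdot>\<^sub>m \<Phi> B"
    using assms unfolding lin_map_def by blast
  moreover have "\<Phi> A \<in> carrier_mat k k" "\<Phi> B \<in> carrier_mat k k"
    using assms lin_map_carrier by blast+
  ultimately show ?thesis using assms by auto
qed

lemma cext_index:
  assumes "lin_map n k \<Phi>" "X \<in> carrier_mat n n" "p < k" "q < k"
  shows "cext \<Phi> X $$ (p,q) = \<Phi> (hre X) $$ (p,q) + \<i> * \<Phi> (him X) $$ (p,q)"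
  using lin_map_carrier[OF assms(1) hre_herm[OF assms(2)]]
    lin_map_carrier[OF assms(1) him_herm[OF assms(2)]] assms
  by (auto simp: cext_alt)

lemma cext_add:
  assumes L: "lin_map n k \<Phi>" and X: "X \<in> carrier_mat n n" and Y: "Y \<in> carrier_mat n n"
    and pq: "p < k" "q < k"
  shows "cext \<Phi> (X + Y) $$ (p,q) = cext \<Phi> X $$ (p,q) + cext \<Phi> Y $$ (p,q)"
proof -
  have "hre (X + Y) = complex_of_real 1 \<cdot>\<^sub>m hre X + complex_of_real 1 \<cdot>\<^sub>m hre Y"
    using X Y
    by (intro eq_matI) (auto simp: hre_index[of _ n] field_simps)
  moreover have "him (X + Y) = complex_of_real 1 \<cdot>\<^sub>m him X + complex_of_real 1 \<cdot>\<^sub>m him Y"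
    using X Y
    by (intro eq_matI) (auto simp: him_index[of _ n] field_simps)
  moreover have XY: "X + Y \<in> carrier_mat n n" using X Y by simp
  ultimately show ?thesis
    unfolding cext_index[OF L X pq] cext_index[OF L Y pq] cext_index[OF L XY pq]
    by (simp only: lin_map_lincomb_index[OF L hre_herm[OF X] hre_herm[OF Y] pq refl]
      lin_map_lincomb_index[OF L him_herm[OF X] him_herm[OF Y] pq refl])
      (simp add: algebra_simps)
qed

lemma cext_smult:
  assumes L: "lin_map n k \<Phi>" and X: "X \<in> carrier_mat n n" and pq: "p < k" "q < k"
  shows "cext \<Phi> (c \<cdot>\<^sub>m X) $$ (p,q) = c * cext \<Phi> X $$ (p,q)"
proof -
  have 1: "hre (c \<cdot>\<^sub>m X) = complex_of_real (Re c) \<cdot>\<^sub>m hre X + complex_of_real (- Im c) \<cdot>\<^sub>m him X"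
    using X
    by (intro eq_matI) (auto simp: hre_index[of _ n] him_index[of _ n] complex_eq_iff field_simps)
  have 2: "him (c \<cdot>\<^sub>m X) = complex_of_real (Im c) \<cdot>\<^sub>m hre X + complex_of_real (Re c) \<cdot>\<^sub>m him X"
    using X
    by (intro eq_matI) (auto simp: hre_index[of _ n] him_index[of _ n] complex_eq_iff field_simps)
  have cX: "c \<cdot>\<^sub>m X \<in> carrier_mat n n" using X by simp
  show ?thesis
    unfolding cext_index[OF L X pq] cext_index[OF L cX pq]
      lin_map_lincomb_index[OF L hre_herm[OF X] him_herm[OF X] pq 1]
      lin_map_lincomb_index[OF L hre_herm[OF X] him_herm[OF X] pq 2]
    by (simp add: complex_eq_iff algebra_simps)
qed

lemma linear_functional_expand:
  fixes T :: "complex mat \<Rightarrow> complex"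
  assumes add: "\<And>X Y. X \<in> carrier_mat n n \<Longrightarrow> Y \<in> carrier_mat n n \<Longrightarrow> T (X + Y) = T X + T Y"
    and smult: "\<And>c X. X \<in> carrier_mat n n \<Longrightarrow> T (c \<cdot>\<^sub>m X) = c * T X"
    and X: "X \<in> carrier_mat n n"
  shows "T X = (\<Sum>a<n. \<Sum>b<n. X $$ (a,b) * T (emat n a b))"
proof -
  define R where "R S = mat n n (\<lambda>(i,j). if (i,j) \<in> S then X $$ (i,j) else 0)" for S
  have Rc: "R S \<in> carrier_mat n n" for S by (simp add: R_def)
  have ec: "emat n a b \<in> carrier_mat n n" for a b by (simp add: emat_def)
  have "finite S \<Longrightarrow> S \<subseteq> {..<n} \<times> {..<n} \<Longrightarrow>
      T (R S) = (\<Sum>(a,b)\<in>S. X $$ (a,b) * T (emat n a b))" for S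
  proof (induction S rule: finite_induct)
    case empty
    have "R {} = 0 \<cdot>\<^sub>m X" using X by (intro eq_matI) (auto simp: R_def)
    then show ?case using smult[OF X, of 0] by simp
  next
    case (insert s S)
    obtain a b where s: "s = (a,b)" by force
    have "R (insert s S) = X $$ (a,b) \<cdot>\<^sub>m emat n a b + R S"
      using insert s by (intro eq_matI) (auto simp: R_def emat_def)
    then show ?case using insert s by (simp add: add smult Rc ec)
  qed
  from this[of "{..<n} \<times> {..<n}"]
  have "T (R ({..<n} \<times> {..<n})) = (\<Sum>a<n. \<Sum>b<n. X $$ (a,b) * T (emat n a b))"
    by (simp add: sum.cartesian_product)
  moreover have "R ({..<n} \<times> {..<n}) = X" using X by (intro eq_matI) (auto simp: R_def)
  ultimately show ?thesis by simp
qed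

lemma emat_carrier [simp]: "emat n a b \<in> carrier_mat n n"
  and emat_dim [simp]: "dim_row (emat n a b) = n" "dim_col (emat n a b) = n"
  by (simp_all add: emat_def)

lemma emat_index: "i < n \<Longrightarrow> j < n \<Longrightarrow> emat n a b $$ (i,j) = (if i = a \<and> j = b then 1 else 0)"
  by (simp add: emat_def)

lemma emat_cnj: "i < n \<Longrightarrow> j < n \<Longrightarrow> cnj (emat n a b $$ (i,j)) = emat n b a $$ (j,i)"
  by (simp add: emat_index conj_commute)

lemma cext_kern:
  assumes L: "lin_map n k \<Phi>" and X: "X \<in> carrier_mat n n" and pq: "p < k" "q < k"
  shows "cext \<Phi> X $$ (p,q) = (\<Sum>a<n. \<Sum>b<n. X $$ (a,b) * kern n \<Phi> a b p q)"
  unfolding kern_def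
  by (rule linear_functional_expand[OF _ _ X]) (simp_all add: cext_add[OF L _ _ pq] cext_smult[OF L _ pq])

lemma cext_herm:
  assumes L: "lin_map n k \<Phi>" and X: "X \<in> herm n" and pq: "p < k" "q < k"
  shows "cext \<Phi> X $$ (p,q) = \<Phi> X $$ (p,q)"
proof -
  have Xc: "X \<in> carrier_mat n n" using X by (rule herm_carrier)
  have 1: "hre X = X"
    using Xc by (intro eq_matI) (auto simp: hre_index[OF Xc] herm_cnj[OF X])
  have "him X = complex_of_real 0 \<cdot>\<^sub>m X + complex_of_real 0 \<cdot>\<^sub>m X"
    using Xc by (intro eq_matI) (auto simp: him_index[OF Xc] herm_cnj[OF X])
  from lin_map_lincomb_index[OF L X X pq this]
  show ?thesis unfolding cext_index[OF L Xc pq] 1 by simp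
qed

lemma lin_map_kern:
  assumes "lin_map n k \<Phi>" "X \<in> herm n" "p < k" "q < k"
  shows "\<Phi> X $$ (p,q) = (\<Sum>a<n. \<Sum>b<n. X $$ (a,b) * kern n \<Phi> a b p q)"
  using cext_kern[OF assms(1) herm_carrier[OF assms(2)] assms(3,4)] cext_herm[OF assms] by simp

lemma kern_hermitian:
  assumes L: "lin_map n k \<Phi>" and pq: "p < k" "q < k"
  shows "cnj (kern n \<Phi> a b p q) = kern n \<Phi> b a q p"
proof -
  let ?E = "emat n a b" and ?F = "emat n b a"
  have Ec: "?E \<in> carrier_mat n n" "?F \<in> carrier_mat n n" by simp_all
  have 1: "hre ?F = hre ?E"
    by (intro eq_matI) (simp_all add: hre_index[OF Ec(1)] hre_index[OF Ec(2)] emat_cnj add.commute)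
  have "him ?F = complex_of_real (-1) \<cdot>\<^sub>m him ?E + complex_of_real 0 \<cdot>\<^sub>m him ?E"
    by (intro eq_matI) (simp_all add: him_index[OF Ec(1)] him_index[OF Ec(2)] emat_cnj algebra_simps)
  from lin_map_lincomb_index[OF L him_herm[OF Ec(1)] him_herm[OF Ec(1)] pq(2,1) this]
  show ?thesis
    unfolding kern_def cext_index[OF L Ec(1) pq] cext_index[OF L Ec(2) pq(2,1)] 1
    using herm_cnj[OF lin_map_herm[OF L hre_herm[OF Ec(1)]] pq]
      herm_cnj[OF lin_map_herm[OF L him_herm[OF Ec(1)]] pq] by simp
qed

lemma mtrace_carrier: "X \<in> carrier_mat n n \<Longrightarrow> mtrace X = (\<Sum>i<n. X $$ (i,i))"
  by (auto simp: mtrace_def)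

lemma kern_trace:
  assumes L: "lin_map n k \<Phi>" and T: "trace_pres n \<Phi>" and ab: "a < n" "b < n"
  shows "(\<Sum>p<k. kern n \<Phi> a b p p) = (if a = b then 1 else 0)"
proof -
  let ?E = "emat n a b"
  have tr: "(\<Sum>p<k. \<Phi> Y $$ (p,p)) = (\<Sum>i<n. Y $$ (i,i))" if "Y \<in> herm n" for Y
    unfolding mtrace_carrier[OF lin_map_carrier[OF L that], symmetric]
      mtrace_carrier[OF herm_carrier[OF that], symmetric]
    using T that by (simp add: trace_pres_def)
  have E: "?E \<in> carrier_mat n n" by simp
  have "(\<Sum>p<k. kern n \<Phi> a b p p) = (\<Sum>i<n. hre ?E $$ (i,i) + \<i> * him ?E $$ (i,i))"
    unfolding kern_def using tr[OF hre_herm[OF E]] tr[OF him_herm[OF E]]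
    by (simp add: cext_index[OF L E] sum.distrib sum_distrib_left[symmetric])
  also have "\<dots> = (\<Sum>i<n. ?E $$ (i,i))"
    using hre_him[OF E] by simp
  also have "\<dots> = (\<Sum>i<n. if i = a then (if a = b then 1 else 0) else 0)"
    by (intro sum.cong refl) (auto simp: emat_index)
  finally show ?thesis using ab by simp
qed

lemma kmap_carrier [simp]: "kmap n k K X \<in> carrier_mat k k"
  by (simp add: kmap_def)

lemma kmap_index: "p < k \<Longrightarrow> q < k \<Longrightarrow> kmap n k K X $$ (p,q) = (\<Sum>a<n. \<Sum>b<n. X $$ (a,b) * K a b p q)"
  by (simp add: kmap_def)

lemma lin_map_kmap:
  assumes K: "\<And>a b p q. a < n \<Longrightarrow> b < n \<Longrightarrow> p < k \<Longrightarrow> q < k \<Longrightarrow> cnj (K a b p q) = K b a q p"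
  shows "lin_map n k (kmap n k K)"
  unfolding lin_map_def
proof (intro conjI ballI allI)
  fix A assume A: "A \<in> herm n"
  show "kmap n k K A \<in> herm k"
  proof (intro hermI kmap_carrier)
    fix p q assume pq: "p < k" "q < k"
    have "cnj (kmap n k K A $$ (p,q)) = (\<Sum>a<n. \<Sum>b<n. A $$ (b,a) * K b a q p)"
      unfolding kmap_index[OF pq] cnj_sum using pq
      by (intro sum.cong refl) (simp add: K herm_cnj[OF A])
    also have "\<dots> = kmap n k K A $$ (q,p)"
      unfolding kmap_index[OF pq(2,1)] by (rule sum.swap)
    finally show "cnj (kmap n k K A $$ (p,q)) = kmap n k K A $$ (q,p)" .
  qed
next
  fix A B :: "complex mat" and a b :: real
  assume "A \<in> herm n" "B \<in> herm n"
  then have "A \<in> carrier_mat n n" "B \<in> carrier_mat n n" by (auto dest: herm_carrier)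
  then have AB: "(complex_of_real a \<cdot>\<^sub>m A + complex_of_real b \<cdot>\<^sub>m B) $$ (c,d) =
      a * A $$ (c,d) + b * B $$ (c,d)" if "c < n" "d < n" for c d
    using that by auto
  have "(\<Sum>c<n. \<Sum>d<n. (complex_of_real a \<cdot>\<^sub>m A + complex_of_real b \<cdot>\<^sub>m B) $$ (c,d) * K c d p q) =
      a * (\<Sum>c<n. \<Sum>d<n. A $$ (c,d) * K c d p q) + b * (\<Sum>c<n. \<Sum>d<n. B $$ (c,d) * K c d p q)" for p q
    unfolding sum_distrib_left sum.distrib[symmetric]
    by (intro sum.cong refl) (simp only: AB lessThan_iff distrib_right mult.assoc)
  then show "kmap n k K (complex_of_real a \<cdot>\<^sub>m A + complex_of_real b \<cdot>\<^sub>m B) =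
      complex_of_real a \<cdot>\<^sub>m kmap n k K A + complex_of_real b \<cdot>\<^sub>m kmap n k K B"
    by (intro eq_matI) (simp_all only: kmap_def index_mat dim_row_mat dim_col_mat index_add_mat index_smult_mat split_conv)
qed

lemma kern_kmap:
  assumes K: "\<And>a b p q. a < n \<Longrightarrow> b < n \<Longrightarrow> p < k \<Longrightarrow> q < k \<Longrightarrow> cnj (K a b p q) = K b a q p"
    and ab: "a < n" "b < n" and pq: "p < k" "q < k"
  shows "kern n (kmap n k K) a b p q = K a b p q"
proof -
  have E: "emat n a b \<in> carrier_mat n n" by simp
  have L: "lin_map n k (kmap n k K)" by (rule lin_map_kmap) (rule K)
  have "kern n (kmap n k K) a b p q =
     (\<Sum>c<n. \<Sum>d<n. (hre (emat n a b) $$ (c,d) + \<i> * him (emat n a b) $$ (c,d)) * K c d p q)"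
    unfolding kern_def cext_index[OF L E pq] kmap_index[OF pq]
    unfolding sum_distrib_left sum.distrib[symmetric]
    by (intro sum.cong refl) (simp only: distrib_right mult.assoc)
  also have "\<dots> = (\<Sum>c<n. \<Sum>d<n. emat n a b $$ (c,d) * K c d p q)"
    by (intro sum.cong refl) (simp add: hre_him[OF E])
  also have "\<dots> = (\<Sum>c<n. \<Sum>d<n. if c = a then (if d = b then K a b p q else 0) else 0)"
    by (intro sum.cong refl) (auto simp: emat_index)
  also have "\<dots> = (\<Sum>c<n. if c = a then (\<Sum>d<n. if d = b then K a b p q else 0) else 0)"
    by (intro sum.cong refl) auto
  finally show ?thesis using ab by simp
qed

lemma sum_nat_prod:
  fixes f :: "nat \<Rightarrow> 'a::comm_monoid_add"
  shows "(\<Sum>i<n*m. f i) = (\<Sum>a<n. \<Sum>c<m. f (a*m+c))"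
proof -
  have "sum f {..<n*m} = (\<Sum>a<n. sum f {a*m..<a*m+m})" by (rule sum.nat_group[symmetric])
  also have "\<dots> = (\<Sum>a<n. \<Sum>c<m. f (a*m+c))"
  proof (rule sum.cong[OF refl])
    fix a
    show "sum f {a*m..<a*m+m} = (\<Sum>c<m. f (a*m+c))"
      by (rule sum.reindex_bij_witness[of _ "\<lambda>c. a*m + c" "\<lambda>i. i - a*m"]) auto
  qed
  finally show ?thesis .
qed

lemma prod_index_bound: "a < n \<Longrightarrow> c < m \<Longrightarrow> a * m + c < n * (m::nat)"
  using mult_le_mono1[of "Suc a" n m] by simp

lemma div_mod_index:
  "c < m \<Longrightarrow> (a * m + c) div m = a" "c < m \<Longrightarrow> (a * m + c) mod m = (c::nat)"
  by simp_all

definition tkern :: "nat \<Rightarrow> nat \<Rightarrow> (nat \<Rightarrow> nat \<Rightarrow> nat \<Rightarrow> nat \<Rightarrow> complex) \<Rightarrow>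
    (nat \<Rightarrow> nat \<Rightarrow> nat \<Rightarrow> nat \<Rightarrow> complex) \<Rightarrow> nat \<Rightarrow> nat \<Rightarrow> nat \<Rightarrow> nat \<Rightarrow> complex" where
  "tkern m l K G A B i j = K (A div m) (B div m) (i div l) (j div l) * G (A mod m) (B mod m) (i mod l) (j mod l)"

lemma tensor_map_eq_kmap:
  "tensor_map n k m l \<Phi> \<Omega> = kmap (n*m) (k*l) (tkern m l (kern n \<Phi>) (kern m \<Omega>))"
proof
  fix X
  have "(\<Sum>a<n. \<Sum>b<n. \<Sum>c<m. \<Sum>d<m. X $$ (a*m+c, b*m+d) * kern n \<Phi> a b p q * kern m \<Omega> c d r s)
     = (\<Sum>A<n*m. \<Sum>B<n*m. X $$ (A,B) * (kern n \<Phi> (A div m) (B div m) p q * kern m \<Omega> (A mod m) (B mod m) r s))"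
    for p q r s
    unfolding sum_nat_prod
    by (rule sum.cong[OF refl], subst sum.swap, intro sum.cong refl)
      (simp only: div_mod_index lessThan_iff mult.assoc)
  then show "tensor_map n k m l \<Phi> \<Omega> X = kmap (n*m) (k*l) (tkern m l (kern n \<Phi>) (kern m \<Omega>)) X"
    unfolding tensor_map_def kmap_def tkern_def kern_def[symmetric] by (simp only:)
qed

lemma div_mod_bound: "A < n * m \<Longrightarrow> A div m < n \<and> A mod m < (m::nat)"
  by (metis less_mult_imp_div_less mod_less_divisor mult_is_0 neq0_conv not_less0)

lemma tkern_hermitian:
  assumes "lin_map n k \<Phi>" "lin_map m l \<Omega>" "i < k * l" "j < k * l"
  shows "cnj (tkern m l (kern n \<Phi>) (kern m \<Omega>) A B i j) = tkern m l (kern n \<Phi>) (kern m \<Omega>) B A j i"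
  using assms div_mod_bound[of i k l] div_mod_bound[of j k l]
  by (simp add: tkern_def kern_hermitian)

lemma lin_map_tensor:
  assumes "lin_map n k \<Phi>" "lin_map m l \<Omega>"
  shows "lin_map (n*m) (k*l) (tensor_map n k m l \<Phi> \<Omega>)"
  unfolding tensor_map_eq_kmap by (rule lin_map_kmap) (rule tkern_hermitian[OF assms])

lemma kern_tensor:
  assumes "lin_map n k \<Phi>" "lin_map m l \<Omega>"
    and "A < n * m" "B < n * m" "i < k * l" "j < k * l"
  shows "kern (n*m) (tensor_map n k m l \<Phi> \<Omega>) A B i j = tkern m l (kern n \<Phi>) (kern m \<Omega>) A B i j"
  unfolding tensor_map_eq_kmap by (rule kern_kmap) (use assms tkern_hermitian[OF assms(1,2)] in auto)

lemma trace_pres_tensor: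
  assumes L: "lin_map n k \<Phi>" "lin_map m l \<Omega>" and T: "trace_pres n \<Phi>" "trace_pres m \<Omega>"
  shows "trace_pres (n*m) (tensor_map n k m l \<Phi> \<Omega>)"
  unfolding trace_pres_def
proof
  fix X assume X: "X \<in> herm (n*m)"
  have tr: "(\<Sum>i<k*l. tkern m l (kern n \<Phi>) (kern m \<Omega>) A B i i) = (if A = B then 1 else 0)"
    if A: "A < n * m" and B: "B < n * m" for A B
  proof -
    have "(\<Sum>i<k*l. tkern m l (kern n \<Phi>) (kern m \<Omega>) A B i i) =
       (\<Sum>p<k. kern n \<Phi> (A div m) (B div m) p p) * (\<Sum>r<l. kern m \<Omega> (A mod m) (B mod m) r r)"
      unfolding sum_nat_prod tkern_def sum_product by (intro sum.cong refl) simp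
    also have "\<dots> = (if A div m = B div m then 1 else 0) * (if A mod m = B mod m then 1 else 0)"
      using div_mod_bound[OF A] div_mod_bound[OF B] by (simp add: kern_trace[OF L(1) T(1)] kern_trace[OF L(2) T(2)])
    also have "\<dots> = (if A = B then 1 else 0)"
      by (auto) (metis div_mult_mod_eq)
    finally show ?thesis .
  qed
  have "mtrace (tensor_map n k m l \<Phi> \<Omega> X) = (\<Sum>i<k*l. \<Sum>A<n*m. \<Sum>B<n*m. X $$ (A,B) * tkern m l (kern n \<Phi>) (kern m \<Omega>) A B i i)"
    unfolding tensor_map_eq_kmap by (simp add: mtrace_carrier[OF kmap_carrier] kmap_index)
  also have "\<dots> = (\<Sum>A<n*m. \<Sum>B<n*m. X $$ (A,B) * (\<Sum>i<k*l. tkern m l (kern n \<Phi>) (kern m \<Omega>) A B i i))"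
    unfolding sum_distrib_left
    by (subst sum.swap, rule sum.cong[OF refl], rule sum.swap)
  also have "\<dots> = (\<Sum>A<n*m. \<Sum>B<n*m. if A = B then X $$ (A,B) else 0)"
    by (intro sum.cong refl) (simp add: tr)
  also have "\<dots> = mtrace X" using mtrace_carrier[OF herm_carrier[OF X]] by simp
  finally show "mtrace (tensor_map n k m l \<Phi> \<Omega> X) = mtrace X" .
qed

section \<open>The norm on pure states and the minimal output entropy\<close>

definition fnorm :: "'b set \<Rightarrow> ('b \<Rightarrow> 'b \<Rightarrow> complex) \<Rightarrow> real" where
  "fnorm B f = L2_set (\<lambda>x. cmod (f (fst x) (snd x))) (B \<times> B)"

definition kout :: "'a set \<Rightarrow> ('a \<Rightarrow> 'a \<Rightarrow> 'b \<Rightarrow> 'b \<Rightarrow> complex) \<Rightarrow> ('a \<Rightarrow> complex) \<Rightarrow> 'b \<Rightarrow> 'b \<Rightarrow> complex" where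
  "kout A K v p q = (\<Sum>a\<in>A. \<Sum>b\<in>A. v a * cnj (v b) * K a b p q)"

definition sqn :: "'a set \<Rightarrow> ('a \<Rightarrow> complex) \<Rightarrow> real" where
  "sqn A v = (\<Sum>a\<in>A. (cmod (v a))\<^sup>2)"

definition is_norm :: "'a set \<Rightarrow> 'b set \<Rightarrow> ('a \<Rightarrow> 'a \<Rightarrow> 'b \<Rightarrow> 'b \<Rightarrow> complex) \<Rightarrow> real \<Rightarrow> bool" where
  "is_norm A B K N \<longleftrightarrow> (\<forall>v. fnorm B (kout A K v) \<le> N * sqn A v) \<and>
     (\<forall>C. (\<forall>v. fnorm B (kout A K v) \<le> C * sqn A v) \<longrightarrow> N \<le> C)"

lemma fnorm_nonneg [simp]: "0 \<le> fnorm B f"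
  by (simp add: fnorm_def)

lemma sqn_nonneg [simp]: "0 \<le> sqn A v"
  by (simp add: sqn_def sum_nonneg)

lemma fnorm_power2: "(fnorm B f)\<^sup>2 = (\<Sum>p\<in>B. \<Sum>q\<in>B. (cmod (f p q))\<^sup>2)"
  by (simp add: fnorm_def L2_set_def sum_nonneg sum.cartesian_product case_prod_beta)

lemma fnorm_cong:
  assumes "\<And>p q. p \<in> B \<Longrightarrow> q \<in> B \<Longrightarrow> f p q = g p q"
  shows "fnorm B f = fnorm B g"
  unfolding fnorm_def by (rule L2_set_cong) (use assms in auto)

lemma fnorm_scale: "fnorm B (\<lambda>p q. c * f p q) = cmod c * fnorm B f"
  unfolding fnorm_def by (simp add: norm_mult L2_set_right_distrib)

lemma fnorm_add: "fnorm B (\<lambda>p q. f p q + g p q) \<le> fnorm B f + fnorm B g"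
proof -
  have "fnorm B (\<lambda>p q. f p q + g p q) \<le>
      L2_set (\<lambda>x. cmod (f (fst x) (snd x)) + cmod (g (fst x) (snd x))) (B \<times> B)"
    unfolding fnorm_def by (intro L2_set_mono norm_triangle_ineq) simp
  also have "\<dots> \<le> fnorm B f + fnorm B g"
    unfolding fnorm_def by (rule L2_set_triangle_ineq)
  finally show ?thesis .
qed

lemma fnorm_zero [simp]: "fnorm B (\<lambda>p q. 0) = 0"
  by (simp add: fnorm_def L2_set_0')

lemma fnorm_sum: "fnorm B (\<lambda>p q. \<Sum>i\<in>I. f i p q) \<le> (\<Sum>i\<in>I. fnorm B (f i))"
proof (induction I rule: infinite_finite_induct)
  case (insert i I)
  have "fnorm B (\<lambda>p q. \<Sum>j\<in>insert i I. f j p q) = fnorm B (\<lambda>p q. f i p q + (\<Sum>j\<in>I. f j p q))"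
    using insert by (intro fnorm_cong) simp
  also have "\<dots> \<le> fnorm B (f i) + fnorm B (\<lambda>p q. \<Sum>j\<in>I. f j p q)" by (rule fnorm_add)
  finally show ?case using insert by simp
qed simp_all

lemma hs_norm_fnorm: "X \<in> carrier_mat k k \<Longrightarrow> hs_norm X = fnorm {..<k} (\<lambda>p q. X $$ (p,q))"
  unfolding hs_norm_def by (simp add: fnorm_power2[symmetric])

lemma kout_scale: "kout A K (\<lambda>a. c * v a) p q = complex_of_real ((cmod c)\<^sup>2) * kout A K v p q"
  unfolding kout_def complex_norm_square sum_distrib_left
  by (intro sum.cong refl) (simp add: ac_simps)

lemma sqn_scale: "sqn A (\<lambda>a. c * v a) = (cmod c)\<^sup>2 * sqn A v"
  by (simp add: sqn_def norm_mult power_mult_distrib sum_distrib_left)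

lemma sqn_eq_0: "finite A \<Longrightarrow> sqn A v = 0 \<Longrightarrow> a \<in> A \<Longrightarrow> v a = 0"
  by (simp add: sqn_def sum_nonneg_eq_0_iff)

lemma kout_zero: "finite A \<Longrightarrow> sqn A v = 0 \<Longrightarrow> kout A K v p q = 0"
  unfolding kout_def by (intro sum.neutral ballI) (simp add: sqn_eq_0)

lemma kout_bounded:
  assumes A: "finite A" and B: "finite B"
  obtains C where "\<And>v. fnorm B (kout A K v) \<le> C * sqn A v"
proof
  fix v
  have le: "cmod (v a) * cmod (v b) \<le> sqn A v" if "a \<in> A" "b \<in> A" for a b
  proof -
    have m: "(cmod (v a))\<^sup>2 \<le> sqn A v" if "a \<in> A" for a
      unfolding sqn_def using A that by (intro member_le_sum) auto
    have "0 \<le> (cmod (v a) - cmod (v b))\<^sup>2" by simp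
    then have "2 * (cmod (v a) * cmod (v b)) \<le> (cmod (v a))\<^sup>2 + (cmod (v b))\<^sup>2"
      by (simp add: power2_diff)
    then show ?thesis using m[OF that(1)] m[OF that(2)] by linarith
  qed
  have "fnorm B (kout A K v) \<le> (\<Sum>x\<in>B\<times>B. cmod (kout A K v (fst x) (snd x)))"
    unfolding fnorm_def by (rule L2_set_le_sum) simp
  also have "\<dots> \<le> (\<Sum>x\<in>B\<times>B. \<Sum>a\<in>A. \<Sum>b\<in>A. sqn A v * cmod (K a b (fst x) (snd x)))"
    unfolding kout_def
    by (intro sum_mono order.trans[OF norm_sum] sum_mono) (simp add: norm_mult le mult_right_mono)
  also have "\<dots> = (\<Sum>x\<in>B\<times>B. \<Sum>a\<in>A. \<Sum>b\<in>A. cmod (K a b (fst x) (snd x))) * sqn A v"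
    by (simp add: sum_distrib_left sum_distrib_right mult.commute)
  finally show "fnorm B (kout A K v) \<le> (\<Sum>x\<in>B\<times>B. \<Sum>a\<in>A. \<Sum>b\<in>A. cmod (K a b (fst x) (snd x))) * sqn A v" .
qed

definition pmat :: "nat \<Rightarrow> (nat \<Rightarrow> complex) \<Rightarrow> complex mat" where
  "pmat n v = mat n n (\<lambda>(i,j). v i * cnj (v j))"

lemma pmat_herm: "pmat n v \<in> herm n"
  by (intro hermI) (auto simp: pmat_def)

lemma mtrace_pmat: "mtrace (pmat n v) = complex_of_real (sqn {..<n} v)"
  unfolding sqn_def of_real_sum complex_norm_square
  by (simp add: mtrace_def pmat_def)

lemma pmat_psd: "pmat n v \<in> psd n"
  unfolding psd_def
proof (intro CollectI conjI ballI pmat_herm)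
  fix x :: "complex vec" assume x: "x \<in> carrier_vec n"
  define t where "t = (\<Sum>j<n. cnj (v j) * x $ j)"
  have "(pmat n v *\<^sub>v x) $ i = v i * t" if "i < n" for i
    using that x unfolding pmat_def t_def sum_distrib_left
    by (auto simp: scalar_prod_def lessThan_atLeast0 mult.assoc intro!: sum.cong)
  then have "(\<Sum>i<n. cnj (x $ i) * (pmat n v *\<^sub>v x) $ i) = (\<Sum>i<n. cnj (cnj (v i) * x $ i)) * t"
    unfolding sum_distrib_right by (intro sum.cong refl) simp
  also have "\<dots> = complex_of_real ((cmod t)\<^sup>2)"
    unfolding complex_norm_square cnj_sum[symmetric] t_def[symmetric] by (rule mult.commute)
  finally show "0 \<le> Re (\<Sum>i<n. cnj (x $ i) * (pmat n v *\<^sub>v x) $ i)" by simp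
qed

lemma spectral_dec_pmat:
  assumes "spectral_dec n A U ev" "i < n" "j < n"
  shows "A $$ (i,j) = (\<Sum>k<n. complex_of_real (ev k) * pmat n (\<lambda>i. U $$ (i,k)) $$ (i,j))"
  using spectral_dec_index[OF assms] assms(2,3) by (simp add: pmat_def mult.assoc)

lemma spectral_dec_col_unit:
  assumes "spectral_dec n A U ev" "k < n"
  shows "sqn {..<n} (\<lambda>i. U $$ (i,k)) = 1"
proof -
  have "complex_of_real (sqn {..<n} (\<lambda>i. U $$ (i,k))) = (\<Sum>i<n. cnj (U $$ (i,k)) * U $$ (i,k))"
    unfolding sqn_def of_real_sum complex_norm_square by (simp add: mult.commute)
  also have "\<dots> = 1" using spectral_dec_orthonormal_cols[OF assms assms(2)] by simp
  finally show ?thesis by (simp only: of_real_eq_1_iff)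
qed

lemma spectral_dec_trace:
  assumes S: "spectral_dec n A U ev" and A: "A \<in> carrier_mat n n"
  shows "mtrace A = complex_of_real (\<Sum>k<n. ev k)"
proof -
  have "mtrace A = (\<Sum>i<n. \<Sum>k<n. complex_of_real (ev k) * pmat n (\<lambda>i. U $$ (i,k)) $$ (i,i))"
    unfolding mtrace_carrier[OF A] by (intro sum.cong refl spectral_dec_pmat[OF S]) auto
  also have "\<dots> = (\<Sum>k<n. complex_of_real (ev k) * mtrace (pmat n (\<lambda>i. U $$ (i,k))))"
    unfolding mtrace_carrier[OF herm_carrier[OF pmat_herm]] sum_distrib_left by (rule sum.swap)
  also have "\<dots> = (\<Sum>k<n. complex_of_real (ev k))"
    unfolding mtrace_pmat by (intro sum.cong refl) (simp add: spectral_dec_col_unit[OF S])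
  finally show ?thesis by simp
qed

lemma spectral_dec_psd:
  assumes S: "spectral_dec n A U ev" and A: "A \<in> psd n" and i: "i < n"
  shows "0 \<le> ev i"
proof -
  have Ac: "A \<in> carrier_mat n n" using A by (auto simp: psd_def herm_def)
  define x where "x = vec n (\<lambda>r. U $$ (r,i))"
  have "(\<Sum>r<n. cnj (x $ r) * (A *\<^sub>v x) $ r) = (\<Sum>r<n. \<Sum>s<n. cnj (U $$ (r,i)) * A $$ (r,s) * U $$ (s,i))"
    using Ac by (auto simp: x_def scalar_prod_def lessThan_atLeast0 sum_distrib_left mult.assoc intro!: sum.cong)
  also have "\<dots> = (\<Sum>r<n. \<Sum>s<n. \<Sum>k<n. complex_of_real (ev k) *
      ((cnj (U $$ (r,i)) * U $$ (r,k)) * (cnj (U $$ (s,k)) * U $$ (s,i))))"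
  proof (intro sum.cong refl)
    fix r s assume "r \<in> {..<n}" "s \<in> {..<n}"
    then have rs: "r < n" "s < n" by auto
    show "cnj (U $$ (r,i)) * A $$ (r,s) * U $$ (s,i) = (\<Sum>k<n. complex_of_real (ev k) *
      ((cnj (U $$ (r,i)) * U $$ (r,k)) * (cnj (U $$ (s,k)) * U $$ (s,i))))"
      unfolding spectral_dec_index[OF S rs] sum_distrib_left sum_distrib_right
      by (intro sum.cong refl) (simp add: ac_simps)
  qed
  also have "\<dots> = (\<Sum>k<n. \<Sum>r<n. \<Sum>s<n. complex_of_real (ev k) *
      ((cnj (U $$ (r,i)) * U $$ (r,k)) * (cnj (U $$ (s,k)) * U $$ (s,i))))"
    by (subst (2) sum.swap, subst sum.swap) (rule refl)
  also have "\<dots> = (\<Sum>k<n. complex_of_real (ev k) * ((\<Sum>r<n. cnj (U $$ (r,i)) * U $$ (r,k)) *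
      (\<Sum>s<n. cnj (U $$ (s,k)) * U $$ (s,i))))"
    unfolding sum_product unfolding sum_distrib_left by (rule refl)
  also have "\<dots> = (\<Sum>k<n. if k = i then complex_of_real (ev i) else 0)"
    by (intro sum.cong refl) (use i in \<open>auto simp: spectral_dec_orthonormal_cols[OF S]\<close>)
  also have "\<dots> = complex_of_real (ev i)" using i by simp
  finally have "(\<Sum>r<n. cnj (x $ r) * (A *\<^sub>v x) $ r) = complex_of_real (ev i)" .
  moreover have "x \<in> carrier_vec n" by (simp add: x_def)
  then have "0 \<le> Re (\<Sum>r<n. cnj (x $ r) * (A *\<^sub>v x) $ r)"
    using A unfolding psd_def by blast
  ultimately show ?thesis by simp
qed

lemma tr_norm_psd:
  assumes "A \<in> psd n"
  shows "tr_norm A = Re (mtrace A)"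
proof -
  have A: "A \<in> herm n" using assms by (simp add: psd_def)
  obtain U ev where S: "spectral_dec n A U ev" using spectral_theorem[OF A] .
  have "tr_norm A = (\<Sum>i<n. ev i)"
    unfolding tr_norm_spectral[OF S] by (intro sum.cong refl) (simp add: spectral_dec_psd[OF S assms])
  then show ?thesis using spectral_dec_trace[OF S herm_carrier[OF A]] by simp
qed

lemma tr_norm_pos:
  assumes A: "A \<in> herm n" "A \<noteq> 0\<^sub>m n n"
  shows "0 < tr_norm A"
proof -
  obtain U ev where S: "spectral_dec n A U ev" using spectral_theorem[OF A(1)] .
  have "tr_norm A \<noteq> 0"
  proof
    assume "tr_norm A = 0"
    then have "\<And>k. k < n \<Longrightarrow> ev k = 0"
      unfolding tr_norm_spectral[OF S] by (simp add: sum_nonneg_eq_0_iff)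
    then have "A = 0\<^sub>m n n"
      using herm_carrier[OF A(1)] by (intro eq_matI) (auto simp: spectral_dec_index[OF S])
    then show False using A by simp
  qed
  moreover have "0 \<le> tr_norm A" unfolding tr_norm_spectral[OF S] by (simp add: sum_nonneg)
  ultimately show ?thesis by simp
qed

lemma lin_map_pmat:
  assumes "lin_map n k \<Phi>" "p < k" "q < k"
  shows "\<Phi> (pmat n v) $$ (p,q) = kout {..<n} (kern n \<Phi>) v p q"
  unfolding lin_map_kern[OF assms(1) pmat_herm assms(2,3)] kout_def
  by (intro sum.cong refl) (simp add: pmat_def)

lemma hs_norm_lin_map_pmat:
  assumes "lin_map n k \<Phi>"
  shows "hs_norm (\<Phi> (pmat n v)) = fnorm {..<k} (kout {..<n} (kern n \<Phi>) v)"
  unfolding hs_norm_fnorm[OF lin_map_carrier[OF assms pmat_herm]]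
  by (rule fnorm_cong) (simp add: lin_map_pmat[OF assms])

lemma hs_norm_le_tr_norm:
  assumes L: "lin_map n k \<Phi>" and X: "X \<in> herm n"
    and C: "\<And>v. fnorm {..<k} (kout {..<n} (kern n \<Phi>) v) \<le> C * sqn {..<n} v"
  shows "hs_norm (\<Phi> X) \<le> C * tr_norm X"
proof -
  obtain U ev where S: "spectral_dec n X U ev" using spectral_theorem[OF X] .
  let ?u = "\<lambda>k i. U $$ (i,k)"
  have "\<Phi> X $$ (p,q) = (\<Sum>i<n. complex_of_real (ev i) * kout {..<n} (kern n \<Phi>) (?u i) p q)"
    if pq: "p < k" "q < k" for p q
  proof -
    have "\<Phi> X $$ (p,q) = (\<Sum>a<n. \<Sum>b<n. \<Sum>i<n. complex_of_real (ev i) *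
        (U $$ (a,i) * cnj (U $$ (b,i)) * kern n \<Phi> a b p q))"
      unfolding lin_map_kern[OF L X pq]
      by (intro sum.cong refl) (simp add: spectral_dec_index[OF S] sum_distrib_right mult.assoc)
    also have "\<dots> = (\<Sum>i<n. \<Sum>a<n. \<Sum>b<n. complex_of_real (ev i) *
        (U $$ (a,i) * cnj (U $$ (b,i)) * kern n \<Phi> a b p q))"
      by (subst (2) sum.swap, subst sum.swap) (rule refl)
    finally show ?thesis unfolding kout_def sum_distrib_left .
  qed
  then have "hs_norm (\<Phi> X) = fnorm {..<k} (\<lambda>p q. \<Sum>i<n. complex_of_real (ev i) * kout {..<n} (kern n \<Phi>) (?u i) p q)"
    unfolding hs_norm_fnorm[OF lin_map_carrier[OF L X]] by (intro fnorm_cong) simp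
  also have "\<dots> \<le> (\<Sum>i<n. \<bar>ev i\<bar> * fnorm {..<k} (kout {..<n} (kern n \<Phi>) (?u i)))"
    by (rule order.trans[OF fnorm_sum]) (simp add: fnorm_scale)
  also have "\<dots> \<le> (\<Sum>i<n. \<bar>ev i\<bar> * C)"
  proof (intro sum_mono mult_left_mono)
    fix i assume "i \<in> {..<n}"
    then show "fnorm {..<k} (kout {..<n} (kern n \<Phi>) (?u i)) \<le> C"
      using C[of "?u i"] spectral_dec_col_unit[OF S, of i] by simp
  qed simp
  also have "\<dots> = C * tr_norm X"
    unfolding tr_norm_spectral[OF S] by (simp add: sum_distrib_left mult.commute)
  finally show ?thesis .
qed

lemma pmat_nonzero: "sqn {..<n} v \<noteq> 0 \<Longrightarrow> pmat n v \<noteq> 0\<^sub>m n n"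
  using mtrace_pmat[of n v] mtrace_carrier[of "0\<^sub>m n n" n] by auto

lemma is_norm_norm12:
  assumes L: "lin_map n k \<Phi>" and n: "0 < n"
  shows "is_norm {..<n} {..<k} (kern n \<Phi>) (norm12 n \<Phi>)"
  unfolding is_norm_def
proof (intro conjI allI impI)
  let ?H = "herm n - {0\<^sub>m n n}"
  have ratio: "hs_norm (\<Phi> X) / tr_norm X \<le> C"
    if "X \<in> ?H" "\<And>v. fnorm {..<k} (kout {..<n} (kern n \<Phi>) v) \<le> C * sqn {..<n} v" for X C
    using that tr_norm_pos[of X n] hs_norm_le_tr_norm[OF L, of X C] by (simp add: pos_divide_le_eq)
  fix v
  show "fnorm {..<k} (kout {..<n} (kern n \<Phi>) v) \<le> norm12 n \<Phi> * sqn {..<n} v"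
  proof (cases "sqn {..<n} v = 0")
    case True
    then have "fnorm {..<k} (kout {..<n} (kern n \<Phi>) v) = fnorm {..<k} (\<lambda>p q. 0)"
      by (intro fnorm_cong) (simp add: kout_zero)
    then show ?thesis using True by simp
  next
    case False
    then have pos: "0 < sqn {..<n} v" using sqn_nonneg[of "{..<n}" v] by linarith
    obtain C where C: "\<And>v. fnorm {..<k} (kout {..<n} (kern n \<Phi>) v) \<le> C * sqn {..<n} v"
      by (rule kout_bounded[of "{..<n}" "{..<k}" "kern n \<Phi>"]) auto
    have "hs_norm (\<Phi> (pmat n v)) / tr_norm (pmat n v) \<le> norm12 n \<Phi>"
      unfolding norm12_def
    proof (rule cSUP_upper)
      show "pmat n v \<in> ?H" using pmat_herm pmat_nonzero False by simp
      show "bdd_above ((\<lambda>\<rho>. hs_norm (\<Phi> \<rho>) / tr_norm \<rho>) ` ?H)"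
        by (rule bdd_aboveI2[of _ _ C]) (rule ratio[OF _ C])
    qed
    moreover have "tr_norm (pmat n v) = sqn {..<n} v"
      by (simp add: tr_norm_psd[OF pmat_psd] mtrace_pmat)
    ultimately show ?thesis
      using pos by (simp add: hs_norm_lin_map_pmat[OF L] pos_divide_le_eq)
  qed
next
  fix C assume C: "\<forall>v. fnorm {..<k} (kout {..<n} (kern n \<Phi>) v) \<le> C * sqn {..<n} v"
  have one: "1\<^sub>m n \<in> herm n" by (intro hermI) auto
  have "1\<^sub>m n \<noteq> (0\<^sub>m n n :: complex mat)"
  proof
    assume "1\<^sub>m n = (0\<^sub>m n n :: complex mat)"
    then have "1\<^sub>m n $$ (0,0) = (0\<^sub>m n n :: complex mat) $$ (0,0)" by simp
    then show False using n by simp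
  qed
  then have ne: "herm n - {0\<^sub>m n n} \<noteq> {}" using one by blast
  show "norm12 n \<Phi> \<le> C"
    unfolding norm12_def
  proof (rule cSUP_least[OF ne])
    fix X assume "X \<in> herm n - {0\<^sub>m n n}"
    then show "hs_norm (\<Phi> X) / tr_norm X \<le> C"
      using C tr_norm_pos[of X n] hs_norm_le_tr_norm[OF L, of X C] by (simp add: pos_divide_le_eq)
  qed
qed

lemma is_norm_unique: "is_norm A B K N \<Longrightarrow> is_norm A B K N' \<Longrightarrow> N = N'"
  unfolding is_norm_def by (meson order.antisym)

lemma is_norm_nonneg:
  assumes "finite A" "A \<noteq> {}" "\<And>v. fnorm B (kout A K v) \<le> C * sqn A v"
  shows "0 \<le> C"
proof -
  have "sqn A (\<lambda>_. 1) = card A" by (simp add: sqn_def)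
  then have "0 < sqn A (\<lambda>_. 1)" using assms by (simp add: card_gt_0_iff)
  moreover have "0 \<le> C * sqn A (\<lambda>_. 1)" using assms(3)[of "\<lambda>_. 1"] fnorm_nonneg order.trans by blast
  ultimately show ?thesis by (simp add: zero_le_mult_iff)
qed

lemma mtrace_mult_herm:
  assumes "X \<in> herm n" "Y \<in> herm n"
  shows "mtrace (X * Y) = (\<Sum>i<n. \<Sum>j<n. X $$ (i,j) * cnj (Y $$ (i,j)))"
proof -
  have c: "X \<in> carrier_mat n n" "Y \<in> carrier_mat n n" using assms by (auto dest: herm_carrier)
  show ?thesis
    unfolding mtrace_carrier[OF mult_carrier_square[OF c]]
    by (intro sum.cong refl) (simp add: index_mult_square[OF c] herm_cnj[OF assms(2)])
qed

lemma mtrace_square_herm: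
  assumes "X \<in> herm n"
  shows "mtrace (X * X) = complex_of_real ((hs_norm X)\<^sup>2)"
  unfolding mtrace_mult_herm[OF assms assms] hs_norm_fnorm[OF herm_carrier[OF assms]] fnorm_power2
    of_real_sum complex_norm_square by (rule refl)

lemma density_pmat: "sqn {..<n} v = 1 \<Longrightarrow> pmat n v \<in> density n"
  by (simp add: density_def pmat_psd mtrace_pmat)

lemma hs_norm_channel_pos:
  assumes L: "lin_map n k \<Phi>" and T: "trace_pres n \<Phi>" and \<rho>: "\<rho> \<in> density n"
  shows "0 < hs_norm (\<Phi> \<rho>)"
proof -
  have h: "\<rho> \<in> herm n" and t: "mtrace \<rho> = 1" using \<rho> by (auto simp: density_def psd_def)
  have "hs_norm (\<Phi> \<rho>) \<noteq> 0"
  proof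
    assume "hs_norm (\<Phi> \<rho>) = 0"
    then have "(\<Sum>p<k. \<Sum>q<k. (cmod (\<Phi> \<rho> $$ (p,q)))\<^sup>2) = 0"
      unfolding hs_norm_fnorm[OF lin_map_carrier[OF L h]] fnorm_power2[symmetric] by simp
    then have "\<And>p. p < k \<Longrightarrow> \<Phi> \<rho> $$ (p,p) = 0"
      by (simp add: sum_nonneg_eq_0_iff sum_nonneg)
    then have "mtrace (\<Phi> \<rho>) = 0"
      by (simp add: mtrace_carrier[OF lin_map_carrier[OF L h]])
    then show False using T h t by (simp add: trace_pres_def)
  qed
  moreover have "0 \<le> hs_norm (\<Phi> \<rho>)"
    unfolding hs_norm_fnorm[OF lin_map_carrier[OF L h]] by simp
  ultimately show ?thesis by simp
qed

lemma unit_vector_sqn: "0 < (n::nat) \<Longrightarrow> sqn {..<n} (\<lambda>i. if i = 0 then 1 else 0) = 1"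
proof -
  assume "0 < n"
  have "sqn {..<n} (\<lambda>i. if i = 0 then 1 else 0) = (\<Sum>i<n. if i = 0 then 1 else 0)"
    unfolding sqn_def by (intro sum.cong refl) auto
  then show ?thesis using \<open>0 < n\<close> by simp
qed

lemma
  assumes L: "lin_map n k \<Phi>" and T: "trace_pres n \<Phi>" and n: "0 < n"
  shows norm12_pos: "0 < norm12 n \<Phi>" and Smin2_norm12: "Smin2 n \<Phi> = - 2 * ln (norm12 n \<Phi>)"
proof -
  let ?N = "norm12 n \<Phi>" and ?K = "kern n \<Phi>" and ?A = "{..<n}" and ?B = "{..<k}"
  note N = is_norm_norm12[OF L n, unfolded is_norm_def]
  let ?e = "\<lambda>i::nat. if i = 0 then 1 else (0::complex)"
  have e: "pmat n ?e \<in> density n" using n by (intro density_pmat unit_vector_sqn)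
  have le: "hs_norm (\<Phi> \<rho>) \<le> ?N" if "\<rho> \<in> density n" for \<rho>
  proof -
    have \<rho>: "\<rho> \<in> psd n" "mtrace \<rho> = 1" using that by (auto simp: density_def)
    then have "tr_norm \<rho> = 1" by (simp add: tr_norm_psd)
    moreover have "hs_norm (\<Phi> \<rho>) \<le> ?N * tr_norm \<rho>"
      using N \<rho> by (intro hs_norm_le_tr_norm[OF L]) (auto simp: psd_def)
    ultimately show ?thesis by simp
  qed
  show Npos: "0 < ?N" using hs_norm_channel_pos[OF L T e] le[OF e] by linarith
  have S2: "S2 (\<Phi> \<rho>) = - 2 * ln (hs_norm (\<Phi> \<rho>))" if "\<rho> \<in> density n" for \<rho>
  proof -
    have h: "\<Phi> \<rho> \<in> herm k" using that L by (auto simp: density_def psd_def lin_map_herm)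
    show ?thesis
      unfolding S2_def mtrace_square_herm[OF h] using hs_norm_channel_pos[OF L T that]
      by (simp add: ln_realpow)
  qed
  have low: "- 2 * ln ?N \<le> S2 (\<Phi> \<rho>)" if "\<rho> \<in> density n" for \<rho>
    using le[OF that] hs_norm_channel_pos[OF L T that] Npos unfolding S2[OF that] by simp
  have "- 2 * ln ?N \<le> Smin2 n \<Phi>"
    unfolding Smin2_def using e low by (intro cINF_greatest) auto
  moreover have "Smin2 n \<Phi> \<le> - 2 * ln ?N"
  proof -
    let ?s = "Smin2 n \<Phi>"
    have bd: "fnorm ?B (kout ?A ?K v) \<le> exp (- ?s / 2) * sqn ?A v" for v
    proof (cases "sqn ?A v = 0")
      case True
      then show ?thesis using N by (metis mult_zero_right)
    next
      case False
      then have pos: "0 < sqn ?A v" using sqn_nonneg[of ?A v] by linarith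
      let ?c = "complex_of_real (1 / sqrt (sqn ?A v))"
      let ?v = "\<lambda>a. ?c * v a"
      have c2: "(cmod ?c)\<^sup>2 = 1 / sqn ?A v"
        using pos by (simp add: norm_divide power_divide)
      have d: "pmat n ?v \<in> density n"
        using pos by (intro density_pmat) (simp only: sqn_scale c2, simp)
      have "?s \<le> S2 (\<Phi> (pmat n ?v))"
        unfolding Smin2_def using low d by (intro cINF_lower bdd_belowI2[of _ "- 2 * ln ?N"]) auto
      then have "ln (hs_norm (\<Phi> (pmat n ?v))) \<le> - ?s / 2" unfolding S2[OF d] by simp
      then have "hs_norm (\<Phi> (pmat n ?v)) \<le> exp (- ?s / 2)"
        using hs_norm_channel_pos[OF L T d] by (metis exp_le_cancel_iff exp_ln)
      also have "hs_norm (\<Phi> (pmat n ?v)) = fnorm ?B (\<lambda>p q. complex_of_real (1 / sqn ?A v) * kout ?A ?K v p q)"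
        unfolding hs_norm_lin_map_pmat[OF L] by (intro fnorm_cong) (simp only: kout_scale c2)
      finally show ?thesis using pos unfolding fnorm_scale by (simp add: norm_divide field_simps)
    qed
    then have "?N \<le> exp (- ?s / 2)" using N by blast
    then have "ln ?N \<le> - ?s / 2" using Npos by (metis ln_exp ln_le_cancel_iff exp_gt_zero)
    then show ?thesis by simp
  qed
  ultimately show "Smin2 n \<Phi> = - 2 * ln ?N" by simp
qed

section \<open>Multiplicativity for Kraus kernels\<close>

lemma gram_identity:
  fixes x y :: "'i \<Rightarrow> 'b \<Rightarrow> complex"
  shows "complex_of_real ((fnorm B (\<lambda>p q. \<Sum>i\<in>I. x i p * cnj (y i q)))\<^sup>2) =
    (\<Sum>i\<in>I. \<Sum>j\<in>I. (\<Sum>p\<in>B. x i p * cnj (x j p)) * cnj (\<Sum>p\<in>B. y i p * cnj (y j p)))"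
proof -
  have "complex_of_real ((fnorm B (\<lambda>p q. \<Sum>i\<in>I. x i p * cnj (y i q)))\<^sup>2) =
     (\<Sum>p\<in>B. \<Sum>q\<in>B. \<Sum>i\<in>I. \<Sum>j\<in>I. (x i p * cnj (x j p)) * cnj (y i q * cnj (y j q)))"
    unfolding fnorm_power2 of_real_sum complex_norm_square cnj_sum sum_product
    by (intro sum.cong refl) (simp add: ac_simps)
  also have "\<dots> = (\<Sum>p\<in>B. \<Sum>i\<in>I. \<Sum>j\<in>I. \<Sum>q\<in>B. (x i p * cnj (x j p)) * cnj (y i q * cnj (y j q)))"
    by (intro sum.cong refl, subst sum.swap, intro sum.cong refl, rule sum.swap)
  also have "\<dots> = (\<Sum>i\<in>I. \<Sum>j\<in>I. \<Sum>p\<in>B. \<Sum>q\<in>B. (x i p * cnj (x j p)) * cnj (y i q * cnj (y j q)))"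
    by (subst sum.swap, intro sum.cong refl, rule sum.swap)
  finally show ?thesis unfolding cnj_sum sum_product .
qed

lemma gram_cauchy_schwarz:
  fixes x y :: "'i \<Rightarrow> 'b \<Rightarrow> complex"
  shows "(fnorm B (\<lambda>p q. \<Sum>i\<in>I. x i p * cnj (y i q)))\<^sup>2
    \<le> fnorm B (\<lambda>p q. \<Sum>i\<in>I. x i p * cnj (x i q)) * fnorm B (\<lambda>p q. \<Sum>i\<in>I. y i p * cnj (y i q))"
proof -
  define g where "g z = (\<lambda>i j. \<Sum>p\<in>B. z i p * cnj (z j p))" for z :: "'i \<Rightarrow> 'b \<Rightarrow> complex"
  have diag: "fnorm I (g z) = fnorm B (\<lambda>p q. \<Sum>i\<in>I. z i p * cnj (z i q))" for z
  proof -
    have "complex_of_real ((fnorm B (\<lambda>p q. \<Sum>i\<in>I. z i p * cnj (z i q)))\<^sup>2) =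
        complex_of_real ((fnorm I (g z))\<^sup>2)"
      unfolding gram_identity unfolding fnorm_power2 of_real_sum complex_norm_square g_def
      by (rule refl)
    then show ?thesis by (simp only: of_real_eq_iff power2_eq_iff_nonneg fnorm_nonneg)
  qed
  have "complex_of_real ((fnorm B (\<lambda>p q. \<Sum>i\<in>I. x i p * cnj (y i q)))\<^sup>2) =
      (\<Sum>z\<in>I\<times>I. g x (fst z) (snd z) * cnj (g y (fst z) (snd z)))"
    unfolding gram_identity g_def by (simp add: sum.cartesian_product case_prod_beta)
  then have "cmod (complex_of_real ((fnorm B (\<lambda>p q. \<Sum>i\<in>I. x i p * cnj (y i q)))\<^sup>2)) \<le>
      (\<Sum>z\<in>I\<times>I. cmod (g x (fst z) (snd z)) * cmod (g y (fst z) (snd z)))"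
    by (auto intro!: sum_norm_le simp: norm_mult)
  also have "\<dots> \<le> fnorm I (g x) * fnorm I (g y)"
    unfolding fnorm_def
    using L2_set_mult_ineq[of "\<lambda>z. cmod (g x (fst z) (snd z))" "\<lambda>z. cmod (g y (fst z) (snd z))" "I \<times> I"]
    by simp
  finally show ?thesis unfolding diag by (simp only: norm_of_real abs_power2)
qed

definition tk :: "('a \<Rightarrow> 'a \<Rightarrow> 'b \<Rightarrow> 'b \<Rightarrow> complex) \<Rightarrow> ('c \<Rightarrow> 'c \<Rightarrow> 'd \<Rightarrow> 'd \<Rightarrow> complex) \<Rightarrow>
    'a \<times> 'c \<Rightarrow> 'a \<times> 'c \<Rightarrow> 'b \<times> 'd \<Rightarrow> 'b \<times> 'd \<Rightarrow> complex" where
  "tk K G x y i j = K (fst x) (fst y) (fst i) (fst j) * G (snd x) (snd y) (snd i) (snd j)"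

definition kraus :: "nat \<Rightarrow> 'c set \<Rightarrow> 'd set \<Rightarrow> ('c \<Rightarrow> 'c \<Rightarrow> 'd \<Rightarrow> 'd \<Rightarrow> complex) \<Rightarrow>
    (nat \<Rightarrow> 'c \<Rightarrow> 'd \<Rightarrow> complex) \<Rightarrow> bool" where
  "kraus r A B G L \<longleftrightarrow> (\<forall>c\<in>A. \<forall>d\<in>A. \<forall>p\<in>B. \<forall>q\<in>B. G c d p q = (\<Sum>i<r. L i c p * cnj (L i d q)))"

definition qbound :: "'a set \<Rightarrow> 'b set \<Rightarrow> ('a \<Rightarrow> 'a \<Rightarrow> 'b \<Rightarrow> 'b \<Rightarrow> complex) \<Rightarrow> real \<Rightarrow> real \<Rightarrow> bool" where
  "qbound A B K \<alpha> \<mu> \<longleftrightarrow> (\<forall>Y. (fnorm B (\<lambda>p q. \<Sum>a\<in>A. \<Sum>b\<in>A. Y a b * K a b p q))\<^sup>2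
      \<le> \<alpha> * (cmod (\<Sum>a\<in>A. Y a a))\<^sup>2 + \<mu> * (fnorm A Y)\<^sup>2)"

lemma kraus_off_diagonal:
  assumes K: "kraus r A B G L"
  shows "(fnorm B (\<lambda>p q. \<Sum>c\<in>A. \<Sum>d\<in>A. u c * cnj (w d) * G c d p q))\<^sup>2
    \<le> fnorm B (kout A G u) * fnorm B (kout A G w)"
proof -
  define x where "x u i p = (\<Sum>c\<in>A. u c * L i c p)" for u i p
  have eq: "(\<Sum>c\<in>A. \<Sum>d\<in>A. u c * cnj (w d) * G c d p q) = (\<Sum>i<r. x u i p * cnj (x w i q))"
    if "p \<in> B" "q \<in> B" for u w p q
  proof -
    have "(\<Sum>c\<in>A. \<Sum>d\<in>A. u c * cnj (w d) * G c d p q) =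
        (\<Sum>c\<in>A. \<Sum>d\<in>A. \<Sum>i<r. (u c * L i c p) * cnj (w d * L i d q))"
      using K that unfolding kraus_def by (intro sum.cong refl) (simp add: sum_distrib_left ac_simps)
    also have "\<dots> = (\<Sum>i<r. \<Sum>c\<in>A. \<Sum>d\<in>A. (u c * L i c p) * cnj (w d * L i d q))"
      by (subst (2) sum.swap, subst sum.swap) (rule refl)
    finally show ?thesis unfolding x_def cnj_sum sum_product .
  qed
  have "fnorm B (kout A G v) = fnorm B (\<lambda>p q. \<Sum>i<r. x v i p * cnj (x v i q))" for v
    unfolding kout_def by (rule fnorm_cong) (rule eq)
  moreover have "fnorm B (\<lambda>p q. \<Sum>c\<in>A. \<Sum>d\<in>A. u c * cnj (w d) * G c d p q) =
      fnorm B (\<lambda>p q. \<Sum>i<r. x u i p * cnj (x w i q))"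
    by (rule fnorm_cong) (rule eq)
  ultimately show ?thesis by (simp add: gram_cauchy_schwarz)
qed

lemma sum_Times: "(\<Sum>x\<in>A \<times> B. f x) = (\<Sum>a\<in>A. \<Sum>b\<in>B. f (a,b))"
  by (simp add: sum.cartesian_product)

lemma fnorm_Times:
  "(fnorm (B \<times> B') f)\<^sup>2 = (\<Sum>q\<in>B'. \<Sum>s\<in>B'. (fnorm B (\<lambda>p r. f (p,q) (r,s)))\<^sup>2)"
proof -
  have "(fnorm (B \<times> B') f)\<^sup>2 = (\<Sum>p\<in>B. \<Sum>q\<in>B'. \<Sum>r\<in>B. \<Sum>s\<in>B'. (cmod (f (p,q) (r,s)))\<^sup>2)"
    unfolding fnorm_power2 sum_Times by (rule refl)
  also have "\<dots> = (\<Sum>q\<in>B'. \<Sum>p\<in>B. \<Sum>s\<in>B'. \<Sum>r\<in>B. (cmod (f (p,q) (r,s)))\<^sup>2)"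
    by (subst sum.swap, intro sum.cong refl, rule sum.swap)
  also have "\<dots> = (\<Sum>q\<in>B'. \<Sum>s\<in>B'. \<Sum>p\<in>B. \<Sum>r\<in>B. (cmod (f (p,q) (r,s)))\<^sup>2)"
    by (intro sum.cong refl, rule sum.swap)
  finally show ?thesis unfolding fnorm_power2 .
qed

lemma sqn_Times: "sqn (A \<times> A') \<psi> = (\<Sum>a\<in>A. sqn A' (\<lambda>c. \<psi> (a,c)))"
  by (simp add: sqn_def sum_Times)

text \<open>The heart of the argument. Applying \<open>id \<otimes> G\<close> to \<open>\<psi>\<psi>\<^sup>*\<close> gives blocks \<open>Y\<^sub>a\<^sub>b\<close>; the bound
  on \<open>K\<close>, applied for each pair of output indices of \<open>G\<close>, leaves the partial trace \<open>\<Sum>\<^sub>a Y\<^sub>a\<^sub>a\<close> and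
  the whole block matrix to be estimated, both by \<open>\<Sum>\<^sub>a \<parallel>Y\<^sub>a\<^sub>a\<parallel>\<close>.\<close>

lemma tensor_bound:
  assumes q: "qbound A B K \<alpha> \<mu>" and \<mu>: "0 \<le> \<mu>" and G: "kraus r A' B' G L"
    and N: "\<And>v. fnorm B' (kout A' G v) \<le> \<nu> * sqn A' v"
  shows "(fnorm (B \<times> B') (kout (A \<times> A') (tk K G) \<psi>))\<^sup>2 \<le> (max \<alpha> 0 + \<mu>) * (\<nu> * sqn (A \<times> A') \<psi>)\<^sup>2"
proof -
  define Y where "Y q s a b = (\<Sum>c\<in>A'. \<Sum>d\<in>A'. \<psi> (a,c) * cnj (\<psi> (b,d)) * G c d q s)" for q s a b
  define S where "S = (\<Sum>a\<in>A. fnorm B' (kout A' G (\<lambda>c. \<psi> (a,c))))"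
  have S0: "0 \<le> S" unfolding S_def by (simp add: sum_nonneg)
  have "S \<le> (\<Sum>a\<in>A. \<nu> * sqn A' (\<lambda>c. \<psi> (a,c)))"
    unfolding S_def by (intro sum_mono N)
  then have S_le: "S \<le> \<nu> * sqn (A \<times> A') \<psi>"
    unfolding sqn_Times sum_distrib_left .
  have out: "kout (A \<times> A') (tk K G) \<psi> (p,q) (r,s) = (\<Sum>a\<in>A. \<Sum>b\<in>A. Y q s a b * K a b p r)" for p q r s
  proof -
    have "kout (A \<times> A') (tk K G) \<psi> (p,q) (r,s) = (\<Sum>a\<in>A. \<Sum>c\<in>A'. \<Sum>b\<in>A. \<Sum>d\<in>A'.
        \<psi> (a,c) * cnj (\<psi> (b,d)) * G c d q s * K a b p r)"
      unfolding kout_def tk_def sum_Times fst_conv snd_conv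
    by (intro sum.cong refl) (simp add: ac_simps)
    also have "\<dots> = (\<Sum>a\<in>A. \<Sum>b\<in>A. \<Sum>c\<in>A'. \<Sum>d\<in>A'. \<psi> (a,c) * cnj (\<psi> (b,d)) * G c d q s * K a b p r)"
      by (intro sum.cong refl, rule sum.swap)
    finally show ?thesis unfolding Y_def sum_distrib_right .
  qed
  have tr: "(\<Sum>q\<in>B'. \<Sum>s\<in>B'. (cmod (\<Sum>a\<in>A. Y q s a a))\<^sup>2) \<le> S\<^sup>2"
  proof -
    have "fnorm B' (\<lambda>q s. \<Sum>a\<in>A. Y q s a a) \<le> S"
      unfolding S_def Y_def kout_def by (rule fnorm_sum)
    then show ?thesis unfolding fnorm_power2[symmetric] by (intro power_mono) auto
  qed
  have bl: "(\<Sum>q\<in>B'. \<Sum>s\<in>B'. (fnorm A (Y q s))\<^sup>2) \<le> S\<^sup>2"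
  proof -
    have "(\<Sum>q\<in>B'. \<Sum>s\<in>B'. (fnorm A (Y q s))\<^sup>2) =
        (\<Sum>q\<in>B'. \<Sum>a\<in>A. \<Sum>b\<in>A. \<Sum>s\<in>B'. (cmod (Y q s a b))\<^sup>2)"
      unfolding fnorm_power2
      by (intro sum.cong refl, subst sum.swap, intro sum.cong refl, rule sum.swap)
    also have "\<dots> = (\<Sum>a\<in>A. \<Sum>b\<in>A. \<Sum>q\<in>B'. \<Sum>s\<in>B'. (cmod (Y q s a b))\<^sup>2)"
      by (subst sum.swap, intro sum.cong refl, rule sum.swap)
    also have "\<dots> = (\<Sum>a\<in>A. \<Sum>b\<in>A. (fnorm B' (\<lambda>q s. Y q s a b))\<^sup>2)"
      unfolding fnorm_power2 by (rule refl)
    also have "\<dots> \<le> (\<Sum>a\<in>A. \<Sum>b\<in>A. fnorm B' (kout A' G (\<lambda>c. \<psi> (a,c))) * fnorm B' (kout A' G (\<lambda>c. \<psi> (b,c))))"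
      unfolding Y_def by (intro sum_mono kraus_off_diagonal[OF G])
    also have "\<dots> = S\<^sup>2" unfolding S_def power2_eq_square sum_product by (rule refl)
    finally show ?thesis .
  qed
  have "(fnorm (B \<times> B') (kout (A \<times> A') (tk K G) \<psi>))\<^sup>2 =
      (\<Sum>q\<in>B'. \<Sum>s\<in>B'. (fnorm B (\<lambda>p r. \<Sum>a\<in>A. \<Sum>b\<in>A. Y q s a b * K a b p r))\<^sup>2)"
    unfolding fnorm_Times out by (rule refl)
  also have "\<dots> \<le> (\<Sum>q\<in>B'. \<Sum>s\<in>B'. \<alpha> * (cmod (\<Sum>a\<in>A. Y q s a a))\<^sup>2 + \<mu> * (fnorm A (Y q s))\<^sup>2)"
    by (intro sum_mono) (use q in \<open>simp add: qbound_def\<close>)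
  also have "\<dots> = \<alpha> * (\<Sum>q\<in>B'. \<Sum>s\<in>B'. (cmod (\<Sum>a\<in>A. Y q s a a))\<^sup>2) + \<mu> * (\<Sum>q\<in>B'. \<Sum>s\<in>B'. (fnorm A (Y q s))\<^sup>2)"
    by (simp add: sum.distrib sum_distrib_left)
  also have "\<dots> \<le> max \<alpha> 0 * S\<^sup>2 + \<mu> * S\<^sup>2"
  proof (intro add_mono mult_left_mono bl \<mu>)
    have "\<alpha> * (\<Sum>q\<in>B'. \<Sum>s\<in>B'. (cmod (\<Sum>a\<in>A. Y q s a a))\<^sup>2) \<le>
        max \<alpha> 0 * (\<Sum>q\<in>B'. \<Sum>s\<in>B'. (cmod (\<Sum>a\<in>A. Y q s a a))\<^sup>2)"
      by (intro mult_right_mono sum_nonneg) auto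
    also have "\<dots> \<le> max \<alpha> 0 * S\<^sup>2" using tr by (intro mult_left_mono) auto
    finally show "\<alpha> * (\<Sum>q\<in>B'. \<Sum>s\<in>B'. (cmod (\<Sum>a\<in>A. Y q s a a))\<^sup>2) \<le> max \<alpha> 0 * S\<^sup>2" .
  qed
  also have "\<dots> = (max \<alpha> 0 + \<mu>) * S\<^sup>2" by (simp add: algebra_simps)
  also have "\<dots> \<le> (max \<alpha> 0 + \<mu>) * (\<nu> * sqn (A \<times> A') \<psi>)\<^sup>2"
    using S_le S0 \<mu> by (intro mult_left_mono power_mono) auto
  finally show ?thesis .
qed

lemma kout_product:
  "kout (A \<times> A') (tk K G) (\<lambda>x. v (fst x) * w (snd x)) (p,q) (r,s) = kout A K v p r * kout A' G w q s"
proof -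
  have "kout (A \<times> A') (tk K G) (\<lambda>x. v (fst x) * w (snd x)) (p,q) (r,s) =
      (\<Sum>a\<in>A. \<Sum>c\<in>A'. \<Sum>b\<in>A. \<Sum>d\<in>A'. (v a * cnj (v b) * K a b p r) * (w c * cnj (w d) * G c d q s))"
    unfolding kout_def tk_def sum_Times fst_conv snd_conv
    by (intro sum.cong refl) (simp add: ac_simps)
  also have "\<dots> = kout A K v p r * kout A' G w q s"
    unfolding kout_def sum_product by (rule refl)
  finally show ?thesis .
qed

lemma fnorm_product: "fnorm (B \<times> B') (\<lambda>x y. f (fst x) (fst y) * g (snd x) (snd y)) = fnorm B f * fnorm B' g"
proof -
  have "fnorm B (\<lambda>p r. f p r * c) = cmod c * fnorm B f" for c
    using fnorm_scale[of B c f] by (simp add: mult.commute)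
  then have "(fnorm (B \<times> B') (\<lambda>x y. f (fst x) (fst y) * g (snd x) (snd y)))\<^sup>2 =
      (\<Sum>q\<in>B'. \<Sum>s\<in>B'. (cmod (g q s))\<^sup>2 * (fnorm B f)\<^sup>2)"
    unfolding fnorm_Times fst_conv snd_conv by (simp only: power_mult_distrib)
  also have "\<dots> = (fnorm B f * fnorm B' g)\<^sup>2"
    unfolding power_mult_distrib fnorm_power2[of B' g] sum_distrib_right[symmetric] by (rule mult.commute)
  finally show ?thesis by (simp add: power2_eq_iff_nonneg)
qed

lemma sqn_product: "sqn (A \<times> A') (\<lambda>x. v (fst x) * w (snd x)) = sqn A v * sqn A' w"
  unfolding sqn_def sum_Times sum_product fst_conv snd_conv norm_mult power_mult_distrib by (rule refl)

lemma is_norm_tensor: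
  assumes A: "finite A" "A \<noteq> {}" and A': "finite A'" "A' \<noteq> {}"
    and q: "qbound A B K \<alpha> \<mu>" and \<mu>: "0 \<le> \<mu>" and G: "kraus r A' B' G L"
    and N: "is_norm A B K N" "N\<^sup>2 = max \<alpha> 0 + \<mu>" and N': "is_norm A' B' G N'"
  shows "is_norm (A \<times> A') (B \<times> B') (tk K G) (N * N')"
  unfolding is_norm_def
proof (intro conjI allI impI)
  have N0: "0 \<le> N" using N(1) A by (intro is_norm_nonneg[of A B K]) (auto simp: is_norm_def)
  have N'0: "0 \<le> N'" using N' A' by (intro is_norm_nonneg[of A' B' G]) (auto simp: is_norm_def)
  have bd': "fnorm B' (kout A' G v) \<le> N' * sqn A' v" for v using N' by (simp add: is_norm_def)
  fix \<psi>
  have "(fnorm (B \<times> B') (kout (A \<times> A') (tk K G) \<psi>))\<^sup>2 \<le> (N * N' * sqn (A \<times> A') \<psi>)\<^sup>2"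
    using tensor_bound[OF q \<mu> G bd', of \<psi>] unfolding N(2)[symmetric]
    by (simp add: power_mult_distrib mult.assoc)
  then show "fnorm (B \<times> B') (kout (A \<times> A') (tk K G) \<psi>) \<le> N * N' * sqn (A \<times> A') \<psi>"
    by (rule power2_le_imp_le) (use N0 N'0 in simp)
next
  fix C assume C: "\<forall>\<psi>. fnorm (B \<times> B') (kout (A \<times> A') (tk K G) \<psi>) \<le> C * sqn (A \<times> A') \<psi>"
  have C0: "0 \<le> C" using C A A' by (intro is_norm_nonneg[of "A \<times> A'" "B \<times> B'" "tk K G"]) auto
  have N0: "0 \<le> N" using N(1) A by (intro is_norm_nonneg[of A B K]) (auto simp: is_norm_def)
  have prod: "fnorm B (kout A K v) * fnorm B' (kout A' G w) \<le> C * (sqn A v * sqn A' w)" for v w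
  proof -
    have "fnorm (B \<times> B') (kout (A \<times> A') (tk K G) (\<lambda>x. v (fst x) * w (snd x))) =
        fnorm (B \<times> B') (\<lambda>x y. kout A K v (fst x) (fst y) * kout A' G w (snd x) (snd y))"
      by (rule fnorm_cong) (auto simp: kout_product)
    then show ?thesis using C[rule_format, of "\<lambda>x. v (fst x) * w (snd x)"]
      by (simp add: fnorm_product sqn_product)
  qed
  have step: "N * fnorm B' (kout A' G w) \<le> C * sqn A' w" for w
  proof (cases "fnorm B' (kout A' G w) = 0")
    case True
    then show ?thesis using C0 by simp
  next
    case False
    then have t: "0 < fnorm B' (kout A' G w)" using fnorm_nonneg[of B' "kout A' G w"] by linarith
    have "\<forall>v. fnorm B (kout A K v) \<le> (C * sqn A' w / fnorm B' (kout A' G w)) * sqn A v"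
      using prod[of _ w] t by (simp add: field_simps)
    then have "N \<le> C * sqn A' w / fnorm B' (kout A' G w)" using N(1) by (simp add: is_norm_def)
    then show ?thesis using t by (simp add: field_simps)
  qed
  show "N * N' \<le> C"
  proof (cases "N = 0")
    case True
    then show ?thesis using C0 by simp
  next
    case False
    then have t: "0 < N" using N0 by linarith
    have "\<forall>w. fnorm B' (kout A' G w) \<le> (C / N) * sqn A' w"
      using step t by (simp add: field_simps)
    then have "N' \<le> C / N" using N' by (simp add: is_norm_def)
    then show ?thesis using t by (simp add: field_simps)
  qed
qed

lemma is_norm_transfer:
  assumes N: "is_norm A B K N" and g: "bij_betw g A' A" and h: "bij_betw h B' B"
    and K': "\<And>a b p q. a \<in> A' \<Longrightarrow> b \<in> A' \<Longrightarrow> p \<in> B' \<Longrightarrow> q \<in> B' \<Longrightarrow> K' a b p q = K (g a) (g b) (h p) (h q)"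
  shows "is_norm A' B' K' N"
proof -
  have sq: "sqn A' (\<lambda>a. v (g a)) = sqn A v" for v
    unfolding sqn_def by (rule sum.reindex_bij_betw[OF g])
  have ko: "kout A' K' (\<lambda>a. v (g a)) p q = kout A K v (h p) (h q)" if "p \<in> B'" "q \<in> B'" for v p q
  proof -
    have "kout A K v (h p) (h q) = (\<Sum>a\<in>A'. \<Sum>b\<in>A'. v (g a) * cnj (v (g b)) * K (g a) (g b) (h p) (h q))"
      unfolding kout_def by (subst sum.reindex_bij_betw[OF g, symmetric], rule sum.cong[OF refl],
        rule sum.reindex_bij_betw[OF g, symmetric])
    then show ?thesis using that K' unfolding kout_def by (auto intro!: sum.cong)
  qed
  have "(fnorm B' (\<lambda>p q. f (h p) (h q)))\<^sup>2 = (fnorm B f)\<^sup>2" for f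
    unfolding fnorm_power2 by (subst (2) sum.reindex_bij_betw[OF h, symmetric], rule sum.cong[OF refl],
        rule sum.reindex_bij_betw[OF h])
  then have fn: "fnorm B' (\<lambda>p q. f (h p) (h q)) = fnorm B f" for f
    by (simp add: power2_eq_iff_nonneg)
  have fk: "fnorm B' (kout A' K' (\<lambda>a. v (g a))) = fnorm B (kout A K v)" for v
    unfolding fn[symmetric] by (rule fnorm_cong) (rule ko)
  have ex: "\<exists>v. fnorm B' (kout A' K' w) = fnorm B (kout A K v) \<and> sqn A' w = sqn A v" for w
  proof -
    define v where "v = (\<lambda>x. w (inv_into A' g x))"
    have w: "v (g a) = w a" if "a \<in> A'" for a
      unfolding v_def using that g by (simp add: bij_betw_inv_into_left)
    have "kout A' K' w p q = kout A' K' (\<lambda>a. v (g a)) p q" for p q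
      unfolding kout_def by (intro sum.cong refl) (simp add: w)
    then have "fnorm B' (kout A' K' w) = fnorm B' (kout A' K' (\<lambda>a. v (g a)))"
      by (intro fnorm_cong) simp
    moreover have "sqn A' w = sqn A' (\<lambda>a. v (g a))"
      unfolding sqn_def by (intro sum.cong refl) (simp add: w)
    ultimately show ?thesis using fk sq by metis
  qed
  have iff: "(\<forall>w. fnorm B' (kout A' K' w) \<le> C * sqn A' w) \<longleftrightarrow> (\<forall>v. fnorm B (kout A K v) \<le> C * sqn A v)" for C
    using ex fk sq by metis
  show ?thesis using N unfolding is_norm_def iff .
qed

lemma bij_betw_div_mod: "bij_betw (\<lambda>A. (A div m, A mod m)) {..<n*m} ({..<n} \<times> {..<m::nat})"
  by (rule bij_betwI[of _ _ _ "\<lambda>(a,c). a * m + c"]) (auto simp: div_mod_bound prod_index_bound)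

lemma is_norm_tkern:
  assumes "is_norm ({..<n} \<times> {..<m}) ({..<k} \<times> {..<l}) (tk K G) N"
  shows "is_norm {..<n*m} {..<k*l} (tkern m l K G) N"
  by (rule is_norm_transfer[OF assms bij_betw_div_mod bij_betw_div_mod]) (simp add: tkern_def tk_def)

lemma is_norm_swap:
  assumes "is_norm (A \<times> A') (B \<times> B') (tk K G) N"
  shows "is_norm (A' \<times> A) (B' \<times> B) (tk G K) N"
  by (rule is_norm_transfer[OF assms, of prod.swap _ prod.swap])
    (auto simp: tk_def mult.commute bij_betw_def)

section \<open>The bound for unital trace-preserving maps\<close>

lemma sum_antisym:
  fixes f :: "nat \<Rightarrow> nat \<Rightarrow> real"
  assumes "\<And>a b. a < n \<Longrightarrow> b < n \<Longrightarrow> f b a = - f a b"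
  shows "(\<Sum>a<n. \<Sum>b<n. f a b) = 0"
proof -
  have "(\<Sum>a<n. \<Sum>b<n. f a b) = (\<Sum>b<n. \<Sum>a<n. f a b)" by (rule sum.swap)
  also have "\<dots> = (\<Sum>b<n. \<Sum>a<n. - f b a)" by (intro sum.cong refl, rule assms) auto
  also have "\<dots> = - (\<Sum>a<n. \<Sum>b<n. f a b)" by (simp add: sum_negf)
  finally show ?thesis by simp
qed

lemma herm_Re_Im:
  assumes "X \<in> herm n" "a < n" "b < n"
  shows "Re (X $$ (b,a)) = Re (X $$ (a,b))" "Im (X $$ (b,a)) = - Im (X $$ (a,b))"
  using herm_cnj[OF assms] by (metis cnj.simps(1), metis cnj.simps(2))

lemma Im_mtrace_mult_herm:
  assumes X: "X \<in> herm n" and Y: "Y \<in> herm n"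
  shows "Im (mtrace (X * Y)) = 0"
  unfolding mtrace_mult_herm[OF X Y] Im_sum
proof (rule sum_antisym)
  fix a b assume "a < n" "b < n"
  then show "Im (X $$ (b,a) * cnj (Y $$ (b,a))) = - Im (X $$ (a,b) * cnj (Y $$ (a,b)))"
    by (simp add: herm_Re_Im[OF X, of a b] herm_Re_Im[OF Y, of a b])
qed

text \<open>The map \<open>X \<mapsto> Re X + Im X\<close> (entrywise) is an isometry from the Hermitian matrices onto
  all real \<open>n \<times> n\<close> arrays, because the symmetric real part and the antisymmetric imaginary
  part are orthogonal.\<close>

definition hvec :: "nat \<Rightarrow> complex mat \<Rightarrow> nat \<Rightarrow> real" where
  "hvec n X i = Re (X $$ (i div n, i mod n)) + Im (X $$ (i div n, i mod n))"

definition hmat :: "nat \<Rightarrow> (nat \<Rightarrow> real) \<Rightarrow> complex mat" where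
  "hmat n x = mat n n (\<lambda>(a,b). Complex ((x (a*n+b) + x (b*n+a)) / 2) ((x (a*n+b) - x (b*n+a)) / 2))"

lemma hvec_inner:
  assumes X: "X \<in> herm n" and Y: "Y \<in> herm n"
  shows "(\<Sum>i<n*n. hvec n X i * hvec n Y i) = Re (mtrace (X * Y))"
proof -
  have "(\<Sum>i<n*n. hvec n X i * hvec n Y i) = (\<Sum>a<n. \<Sum>b<n.
      Re (X $$ (a,b) * cnj (Y $$ (a,b))) + (Re (X $$ (a,b)) * Im (Y $$ (a,b)) + Im (X $$ (a,b)) * Re (Y $$ (a,b))))"
    unfolding sum_nat_prod hvec_def
    by (intro sum.cong refl) (simp add: algebra_simps)
  also have "\<dots> = Re (mtrace (X * Y)) +
      (\<Sum>a<n. \<Sum>b<n. Re (X $$ (a,b)) * Im (Y $$ (a,b)) + Im (X $$ (a,b)) * Re (Y $$ (a,b)))"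
    unfolding mtrace_mult_herm[OF X Y] Re_sum sum.distrib by (rule refl)
  also have "(\<Sum>a<n. \<Sum>b<n. Re (X $$ (a,b)) * Im (Y $$ (a,b)) + Im (X $$ (a,b)) * Re (Y $$ (a,b))) = 0"
  proof (rule sum_antisym)
    fix a b assume "a < n" "b < n"
    then show "Re (X $$ (b,a)) * Im (Y $$ (b,a)) + Im (X $$ (b,a)) * Re (Y $$ (b,a)) =
        - (Re (X $$ (a,b)) * Im (Y $$ (a,b)) + Im (X $$ (a,b)) * Re (Y $$ (a,b)))"
      by (simp add: herm_Re_Im[OF X, of a b] herm_Re_Im[OF Y, of a b])
  qed
  finally show ?thesis by simp
qed

lemma hmat_herm: "hmat n x \<in> herm n"
  by (intro hermI) (auto simp: hmat_def complex_eq_iff algebra_simps diff_divide_distrib)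

lemma hvec_hmat: "i < n * n \<Longrightarrow> hvec n (hmat n x) i = x i"
  using div_mod_bound[of i n n] by (simp add: hvec_def hmat_def field_simps)

lemma herm_index_hvec:
  assumes X: "X \<in> herm n" and ab: "a < n" "b < n"
  shows "X $$ (a,b) = Complex ((hvec n X (a*n+b) + hvec n X (b*n+a)) / 2) ((hvec n X (a*n+b) - hvec n X (b*n+a)) / 2)"
  using ab by (simp add: hvec_def herm_Re_Im[OF X ab] complex_eq_iff)

lemma orthonormal_complete:
  fixes Q :: "nat \<Rightarrow> nat \<Rightarrow> real"
  assumes Q: "\<And>i j. i < N \<Longrightarrow> j < N \<Longrightarrow> (\<Sum>l<N. Q i l * Q j l) = (if i = j then 1 else 0)"
    and l: "l < N" "m < N"
  shows "(\<Sum>i<N. Q i l * Q i m) = (if l = m then 1 else 0)"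
proof -
  define A where "A = mat N N (\<lambda>(i,j). Q i j)"
  have A: "A \<in> carrier_mat N N" "transpose_mat A \<in> carrier_mat N N" by (simp_all add: A_def)
  have "A * transpose_mat A = 1\<^sub>m N"
  proof (rule eq_matI)
    fix i j assume "i < dim_row (1\<^sub>m N :: real mat)" "j < dim_col (1\<^sub>m N :: real mat)"
    then have ij: "i < N" "j < N" by simp_all
    have "(A * transpose_mat A) $$ (i,j) = (\<Sum>l<N. Q i l * Q j l)"
      unfolding index_mult_square[OF A ij] by (intro sum.cong refl) (simp add: A_def ij)
    then show "(A * transpose_mat A) $$ (i,j) = 1\<^sub>m N $$ (i,j)" using Q ij by simp
  qed (simp_all add: A_def)
  then have "transpose_mat A * A = 1\<^sub>m N" using mat_mult_left_right_inverse[OF A] by simp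
  then have "(transpose_mat A * A) $$ (l,m) = (if l = m then 1 else 0)" using l by simp
  then show ?thesis
    unfolding index_mult_square[OF A(2,1) l] using l by (simp add: A_def)
qed

definition scaled_id :: "nat \<Rightarrow> real \<Rightarrow> complex mat" where
  "scaled_id n s = mat n n (\<lambda>(i,j). if i = j then complex_of_real s else 0)"

lemma scaled_id_herm: "scaled_id n s \<in> herm n"
  by (intro hermI) (auto simp: scaled_id_def)

lemma mtrace_scaled_id_mult:
  assumes "X \<in> herm n"
  shows "mtrace (scaled_id n s * X) = s * mtrace X"
proof -
  have "mtrace (scaled_id n s * X) = (\<Sum>i<n. \<Sum>j<n. if j = i then s * cnj (X $$ (i,i)) else 0)"
    unfolding mtrace_mult_herm[OF scaled_id_herm assms]
    by (intro sum.cong refl) (auto simp: scaled_id_def)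
  also have "\<dots> = (\<Sum>i<n. s * X $$ (i,i))"
    by (intro sum.cong refl) (simp add: herm_cnj[OF assms])
  finally show ?thesis unfolding mtrace_carrier[OF herm_carrier[OF assms]] sum_distrib_left .
qed

lemma mtrace_scaled_id: "mtrace (scaled_id n s) = of_nat n * complex_of_real s"
  by (simp add: mtrace_def scaled_id_def)

definition unit_id :: "nat \<Rightarrow> complex mat" where
  "unit_id n = scaled_id n (1 / sqrt n)"

lemma unit_id_herm: "unit_id n \<in> herm n"
  by (simp add: unit_id_def scaled_id_herm)

lemma mtrace_unit_id_square:
  assumes "0 < n"
  shows "mtrace (unit_id n * unit_id n) = 1"
proof -
  have "mtrace (unit_id n * unit_id n) = complex_of_real (1 / sqrt n * (real n * (1 / sqrt n)))"
    unfolding unit_id_def mtrace_scaled_id_mult[OF scaled_id_herm] mtrace_scaled_id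
    by (simp only: of_real_mult of_real_of_nat_eq)
  also have "1 / sqrt n * (real n * (1 / sqrt n)) = 1" using assms by simp
  finally show ?thesis by simp
qed

lemma onb0_exists:
  assumes n: "0 < n"
  shows "\<exists>Ms. onb0 n Ms"
proof -
  let ?N = "n * n"
  have N: "0 < ?N" using n by simp
  have SN: "Suc (n\<^sup>2 - 1) = ?N" using N by (simp add: power2_eq_square)
  let ?v = "\<lambda>l. complex_of_real (hvec n (unit_id n) l)"
  have "(\<Sum>l<?N. ?v l * cnj (?v l)) = complex_of_real (\<Sum>l<?N. hvec n (unit_id n) l * hvec n (unit_id n) l)"
    by simp
  also have "\<dots> = 1" unfolding hvec_inner[OF unit_id_herm unit_id_herm] mtrace_unit_id_square[OF n] by simp
  finally have un: "(\<Sum>l<?N. ?v l * cnj (?v l)) = 1" .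
  obtain W where Wh: "\<And>i j. cnj (W i j) = W j i"
    and Wu: "\<And>i j. i < ?N \<Longrightarrow> j < ?N \<Longrightarrow> (\<Sum>k<?N. W i k * W k j) = (if i = j then 1 else 0)"
    and Wv: "\<And>i. i < ?N \<Longrightarrow> W i 0 = ?v i"
    and Wr: "\<And>i j. W i j \<in> \<real>"
    by (rule householder[OF N un]) auto
  define R where "R i l = Re (W l i)" for i l
  have WR: "W i j = complex_of_real (R j i)" for i j
    unfolding R_def using Wr[of i j] by (simp add: of_real_Re)
  have Rsym: "R j i = R i j" for i j
    using Wh[of i j] unfolding WR by simp
  have Ro: "(\<Sum>l<?N. R i l * R j l) = (if i = j then 1 else 0)" if "i < ?N" "j < ?N" for i j
  proof -
    have "complex_of_real (\<Sum>l<?N. R i l * R j l) = (\<Sum>l<?N. W i l * W l j)"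
      unfolding WR using Rsym by simp
    also have "\<dots> = complex_of_real (if i = j then 1 else 0)" using Wu[OF that] by simp
    finally show ?thesis by (simp only: of_real_eq_iff)
  qed
  have R0: "R 0 l = hvec n (unit_id n) l" if "l < ?N" for l
    using Wv[OF that] unfolding WR by simp
  define M where "M j = hmat n (R (Suc j))" for j
  have Mh: "M j \<in> herm n" for j by (simp add: M_def hmat_herm)
  have inner: "mtrace (X * M j) = complex_of_real (\<Sum>l<?N. hvec n X l * R (Suc j) l)"
    if "X \<in> herm n" for X j
  proof -
    have "(\<Sum>l<?N. hvec n X l * R (Suc j) l) = (\<Sum>l<?N. hvec n X l * hvec n (M j) l)"
      by (intro sum.cong refl) (simp add: M_def hvec_hmat)
    then show ?thesis
      unfolding hvec_inner[OF that Mh] using Im_mtrace_mult_herm[OF that Mh] by (simp add: complex_eq_iff)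
  qed
  define Ms where "Ms = map M [0..<n\<^sup>2 - 1]"
  have "onb0 n Ms"
    unfolding onb0_def
  proof (intro conjI allI impI subsetI)
    show "length Ms = n\<^sup>2 - 1" by (simp add: Ms_def)
  next
    fix X assume "X \<in> set Ms"
    then obtain j where j: "j < n\<^sup>2 - 1" and X: "X = M j" by (auto simp: Ms_def)
    then have j': "Suc j < ?N" using SN by linarith
    have "(\<Sum>l<?N. hvec n (unit_id n) l * R (Suc j) l) = (\<Sum>l<?N. R 0 l * R (Suc j) l)"
      by (intro sum.cong refl) (simp add: R0)
    then have "mtrace (unit_id n * M j) = 0"
      unfolding inner[OF unit_id_herm] using Ro[OF N j'] by (simp only:) simp
    then have "mtrace (M j) = 0"
      using n unfolding unit_id_def mtrace_scaled_id_mult[OF Mh] by simp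
    then show "X \<in> herm0 n" using Mh by (simp add: X herm0_def)
  next
    fix i j assume "i < length Ms" "j < length Ms"
    then have ij: "i < n\<^sup>2 - 1" "j < n\<^sup>2 - 1" by (simp_all add: Ms_def)
    then have ij': "Suc i < ?N" "Suc j < ?N" using SN by linarith+
    have "(\<Sum>l<?N. hvec n (M i) l * R (Suc j) l) = (\<Sum>l<?N. R (Suc i) l * R (Suc j) l)"
      by (intro sum.cong refl) (simp add: M_def hvec_hmat)
    then show "mtrace (Ms ! i * Ms ! j) = (if i = j then 1 else 0)"
      using ij Ro[OF ij'] inner[OF Mh, of i j] by (simp add: Ms_def del: of_real_sum)
  qed
  then show ?thesis by blast
qed

lemma onb0_herm: "onb0 n Ms \<Longrightarrow> j < n\<^sup>2 - 1 \<Longrightarrow> Ms ! j \<in> herm n"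
  unfolding onb0_def herm0_def by (metis (mono_tags, lifting) mem_Collect_eq nth_mem subsetD)

lemma onb0_trace: "onb0 n Ms \<Longrightarrow> j < n\<^sup>2 - 1 \<Longrightarrow> mtrace (Ms ! j) = 0"
  unfolding onb0_def herm0_def by (metis (mono_tags, lifting) mem_Collect_eq nth_mem subsetD)

lemma onb0_hvec_expand:
  assumes n: "0 < n" and O: "onb0 n Ms" and X: "X \<in> herm0 n" and l: "l < n * n"
  shows "hvec n X l = (\<Sum>j<n\<^sup>2 - 1. Re (mtrace (X * Ms ! j)) * hvec n (Ms ! j) l)"
proof -
  let ?N = "n * n"
  have N: "0 < ?N" using n by simp
  have SN: "?N = Suc (n\<^sup>2 - 1)" using N by (simp add: power2_eq_square)
  have Xh: "X \<in> herm n" and Xt: "mtrace X = 0" using X by (auto simp: herm0_def)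
  define B where "B i = (if i = 0 then unit_id n else Ms ! (i - 1))" for i
  have Bh: "B i \<in> herm n" if "i < ?N" for i
    using that SN onb0_herm[OF O, of "i - 1"] by (auto simp: B_def unit_id_herm)
  have ut: "mtrace (unit_id n * Y) = 0" if "Y \<in> herm n" "mtrace Y = 0" for Y
    using that by (simp add: unit_id_def mtrace_scaled_id_mult)
  have comm: "Re (mtrace (Y * Z)) = Re (mtrace (Z * Y))" if "Y \<in> herm n" "Z \<in> herm n" for Y Z
    unfolding hvec_inner[OF that, symmetric] hvec_inner[OF that(2,1), symmetric] by (simp add: mult.commute)
  have orth: "(\<Sum>l<?N. hvec n (B i) l * hvec n (B j) l) = (if i = j then 1 else 0)" if ij: "i < ?N" "j < ?N" for i j
  proof -
    have *: "mtrace (unit_id n * Ms ! (m - 1)) = 0" if "m < ?N" "m \<noteq> 0" for m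
      using that SN by (intro ut onb0_herm[OF O] onb0_trace[OF O]) auto
    have **: "Re (mtrace (Ms ! (i - 1) * unit_id n)) = 0" if "i \<noteq> 0"
      using *[OF ij(1) that] comm[OF unit_id_herm, of "Ms ! (i - 1)"] Bh[OF ij(1)] that by (simp add: B_def)
    have ***: "mtrace (Ms ! (i - 1) * Ms ! (j - 1)) = (if i = j then 1 else 0)" if "i \<noteq> 0" "j \<noteq> 0"
      using O ij that SN unfolding onb0_def by auto
    show ?thesis
      unfolding hvec_inner[OF Bh[OF ij(1)] Bh[OF ij(2)]]
      by (cases "i = 0"; cases "j = 0")
        (simp_all add: B_def mtrace_unit_id_square[OF n] *[OF ij(2)] ** *** del: One_nat_def)
  qed
  have complete: "(\<Sum>i<?N. hvec n (B i) l * hvec n (B i) m) = (if l = m then 1 else 0)"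
    if "l < ?N" "m < ?N" for l m
    using that by (intro orthonormal_complete[of ?N "\<lambda>i. hvec n (B i)"]) (simp_all only: orth)
  have "hvec n X l = (\<Sum>m<?N. hvec n X m * (if m = l then 1 else 0))"
    using l by (simp add: sum_delta_mult)
  also have "\<dots> = (\<Sum>m<?N. \<Sum>i<?N. hvec n X m * hvec n (B i) m * hvec n (B i) l)"
    by (intro sum.cong refl) (simp add: complete[OF _ l, symmetric] sum_distrib_left mult.assoc)
  also have "\<dots> = (\<Sum>i<?N. Re (mtrace (X * B i)) * hvec n (B i) l)"
    by (subst sum.swap, intro sum.cong refl) (simp add: sum_distrib_right[symmetric] hvec_inner[OF Xh Bh])
  also have "\<dots> = Re (mtrace (X * B 0)) * hvec n (B 0) l +
      (\<Sum>j<n\<^sup>2 - 1. Re (mtrace (X * B (Suc j))) * hvec n (B (Suc j)) l)"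
    unfolding SN by (rule sum.lessThan_Suc_shift)
  also have "Re (mtrace (X * B 0)) = 0"
    using ut[OF Xh Xt] comm[OF Xh unit_id_herm] by (simp add: B_def)
  finally show ?thesis by (simp add: B_def)
qed

lemma onb0_expand:
  assumes n: "0 < n" and O: "onb0 n Ms" and X: "X \<in> herm0 n" and ab: "a < n" "b < n"
  shows "X $$ (a,b) = (\<Sum>j<n\<^sup>2 - 1. complex_of_real (Re (mtrace (X * Ms ! j))) * Ms ! j $$ (a,b))"
proof -
  have Xh: "X \<in> herm n" using X by (auto simp: herm0_def)
  define x where "x j = Re (mtrace (X * Ms ! j))" for j
  define u where "u j = hvec n (Ms ! j) (a*n+b)" for j
  define w where "w j = hvec n (Ms ! j) (b*n+a)" for j
  have "hvec n X (a*n+b) = (\<Sum>j<n\<^sup>2 - 1. x j * u j)"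
    unfolding x_def u_def by (rule onb0_hvec_expand[OF n O X prod_index_bound[OF ab]])
  moreover have "hvec n X (b*n+a) = (\<Sum>j<n\<^sup>2 - 1. x j * w j)"
    unfolding x_def w_def by (rule onb0_hvec_expand[OF n O X prod_index_bound[OF ab(2,1)]])
  moreover have "((\<Sum>j<n\<^sup>2 - 1. x j * u j) + (\<Sum>j<n\<^sup>2 - 1. x j * w j)) / 2 = (\<Sum>j<n\<^sup>2 - 1. x j * ((u j + w j) / 2))"
    "((\<Sum>j<n\<^sup>2 - 1. x j * u j) - (\<Sum>j<n\<^sup>2 - 1. x j * w j)) / 2 = (\<Sum>j<n\<^sup>2 - 1. x j * ((u j - w j) / 2))"
    unfolding sum.distrib[symmetric] sum_subtractf[symmetric] sum_divide_distrib
    by (simp_all add: distrib_left right_diff_distrib)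
  ultimately have "X $$ (a,b) = Complex (\<Sum>j<n\<^sup>2 - 1. x j * ((u j + w j) / 2)) (\<Sum>j<n\<^sup>2 - 1. x j * ((u j - w j) / 2))"
    unfolding herm_index_hvec[OF Xh ab] by (simp only:)
  also have "\<dots> = (\<Sum>j<n\<^sup>2 - 1. complex_of_real (x j) * Complex ((u j + w j) / 2) ((u j - w j) / 2))"
    by (simp add: complex_eq_iff)
  also have "\<dots> = (\<Sum>j<n\<^sup>2 - 1. complex_of_real (x j) * Ms ! j $$ (a,b))"
    unfolding u_def w_def by (intro sum.cong refl) (simp add: herm_index_hvec[OF onb0_herm[OF O] ab])
  finally show ?thesis unfolding x_def .
qed

lemma onb0_parseval:
  assumes n: "0 < n" and O: "onb0 n Ms" and X: "X \<in> herm0 n"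
  shows "(hs_norm X)\<^sup>2 = (\<Sum>j<n\<^sup>2 - 1. (Re (mtrace (X * Ms ! j)))\<^sup>2)"
proof -
  have Xh: "X \<in> herm n" using X by (auto simp: herm0_def)
  have "(hs_norm X)\<^sup>2 = (\<Sum>l<n*n. hvec n X l * hvec n X l)"
    unfolding hvec_inner[OF Xh Xh] mtrace_square_herm[OF Xh] by simp
  also have "\<dots> = (\<Sum>l<n*n. \<Sum>j<n\<^sup>2 - 1. Re (mtrace (X * Ms ! j)) * (hvec n X l * hvec n (Ms ! j) l))"
  proof (rule sum.cong[OF refl])
    fix l assume "l \<in> {..<n*n}"
    then have l: "l < n * n" by simp
    have "hvec n X l * hvec n X l = hvec n X l * (\<Sum>j<n\<^sup>2 - 1. Re (mtrace (X * Ms ! j)) * hvec n (Ms ! j) l)"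
      using onb0_hvec_expand[OF n O X l] by simp
    then show "hvec n X l * hvec n X l = (\<Sum>j<n\<^sup>2 - 1. Re (mtrace (X * Ms ! j)) * (hvec n X l * hvec n (Ms ! j) l))"
      unfolding sum_distrib_left by (simp add: mult.left_commute)
  qed
  also have "\<dots> = (\<Sum>j<n\<^sup>2 - 1. (Re (mtrace (X * Ms ! j)))\<^sup>2)"
    by (subst sum.swap, intro sum.cong refl)
      (simp add: sum_distrib_left[symmetric] hvec_inner[OF Xh onb0_herm[OF O]] power2_eq_square)
  finally show ?thesis .
qed

lemma lam_max_bound:
  fixes A :: "real mat"
  assumes A: "A \<in> carrier_mat d d" and sym: "\<And>i j. i < d \<Longrightarrow> j < d \<Longrightarrow> A $$ (i,j) = A $$ (j,i)"
    and d: "0 < d"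
  shows "(\<Sum>i<d. \<Sum>j<d. x i * x j * A $$ (i,j)) \<le> lam_max A * (\<Sum>i<d. (x i)\<^sup>2)"
proof -
  let ?B = "map_mat complex_of_real A"
  have B: "?B \<in> herm d" using A sym by (intro hermI) auto
  obtain U ev where S: "spectral_dec d ?B U ev" using spectral_theorem[OF B] .
  define c where "c k = (\<Sum>i<d. x i * U $$ (i,k))" for k
  have quad: "(\<Sum>i<d. \<Sum>j<d. x i * x j * (\<Sum>k<d. e k * U $$ (i,k) * cnj (U $$ (j,k)))) =
      complex_of_real (\<Sum>k<d. e k * (cmod (c k))\<^sup>2)" for e :: "nat \<Rightarrow> real"
  proof -
    have "(\<Sum>i<d. \<Sum>j<d. x i * x j * (\<Sum>k<d. e k * U $$ (i,k) * cnj (U $$ (j,k)))) =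
        (\<Sum>i<d. \<Sum>j<d. \<Sum>k<d. e k * ((x i * U $$ (i,k)) * cnj (x j * U $$ (j,k))))"
      unfolding sum_distrib_left by (intro sum.cong refl) (simp add: ac_simps)
    also have "\<dots> = (\<Sum>k<d. \<Sum>i<d. \<Sum>j<d. e k * ((x i * U $$ (i,k)) * cnj (x j * U $$ (j,k))))"
      by (subst (2) sum.swap, subst sum.swap) (rule refl)
    also have "\<dots> = (\<Sum>k<d. e k * (c k * cnj (c k)))"
      unfolding c_def cnj_sum sum_product unfolding sum_distrib_left by (rule refl)
    also have "\<dots> = complex_of_real (\<Sum>k<d. e k * (cmod (c k))\<^sup>2)"
      unfolding complex_norm_square[symmetric] by simp
    finally show ?thesis .
  qed
  have fin: "finite {y. eigenvalue A y}"
    unfolding eigenvalue_root_char_poly[OF A]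
    using degree_monic_char_poly[OF A] by (intro poly_roots_finite) auto
  have ev: "ev k \<le> lam_max A" if k: "k < d" for k
  proof -
    have "char_poly ?B = map_poly complex_of_real (char_poly A)"
      by (rule of_real_hom.char_poly_hom[OF A])
    then have "poly (map_poly complex_of_real (char_poly A)) (complex_of_real (ev k)) = 0"
      using k unfolding spectral_dec_char_poly[OF S] by (metis (no_types, lifting) spectral_dec_char_poly[OF S]
        poly_prod prod_zero_iff finite_lessThan lessThan_iff poly_pCons poly_0 mult_zero_right mult_1_right add.right_neutral add.left_inverse)
    then have "poly (char_poly A) (ev k) = 0" by (simp add: of_real_hom.poly_map_poly)
    then have "eigenvalue A (ev k)" unfolding eigenvalue_root_char_poly[OF A] .
    then show ?thesis using d A fin unfolding lam_max_def by auto
  qed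
  have "complex_of_real (\<Sum>i<d. \<Sum>j<d. x i * x j * A $$ (i,j)) =
      (\<Sum>i<d. \<Sum>j<d. x i * x j * (\<Sum>k<d. ev k * U $$ (i,k) * cnj (U $$ (j,k))))"
    unfolding of_real_sum
  proof (intro sum.cong refl)
    fix i j assume "i \<in> {..<d}" "j \<in> {..<d}"
    then have ij: "i < d" "j < d" by auto
    show "complex_of_real (x i * x j * A $$ (i,j)) = x i * x j * (\<Sum>k<d. ev k * U $$ (i,k) * cnj (U $$ (j,k)))"
      unfolding spectral_dec_index[OF S ij, symmetric] using A ij by simp
  qed
  then have 1: "(\<Sum>i<d. \<Sum>j<d. x i * x j * A $$ (i,j)) = (\<Sum>k<d. ev k * (cmod (c k))\<^sup>2)"
    unfolding quad by (simp only: of_real_eq_iff)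
  have "complex_of_real (\<Sum>k<d. 1 * (cmod (c k))\<^sup>2) = (\<Sum>i<d. \<Sum>j<d. complex_of_real (x i * x j) * (if i = j then 1 else 0))"
    unfolding quad[of "\<lambda>_. 1", symmetric]
    by (intro sum.cong refl) (simp add: spectral_dec_orthonormal_rows[OF S])
  also have "\<dots> = (\<Sum>i<d. \<Sum>j<d. if i = j then complex_of_real ((x i)\<^sup>2) else 0)"
    by (intro sum.cong refl) (simp add: power2_eq_square)
  also have "\<dots> = complex_of_real (\<Sum>i<d. (x i)\<^sup>2)" by simp
  finally have 2: "(\<Sum>k<d. (cmod (c k))\<^sup>2) = (\<Sum>i<d. (x i)\<^sup>2)" by (simp only: of_real_eq_iff mult_1)
  show ?thesis
    unfolding 1 2[symmetric] sum_distrib_left by (intro sum_mono mult_right_mono ev) auto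
qed

lemma
  assumes L: "lin_map n k \<Phi>" and n: "0 < n"
  shows A_mat_bound_traceless: "\<And>X. X \<in> herm0 n \<Longrightarrow> (hs_norm (\<Phi> X))\<^sup>2 \<le> lam_max (A_mat n \<Phi>) * (hs_norm X)\<^sup>2"
    and lam_max_A_mat_nonneg: "0 \<le> lam_max (A_mat n \<Phi>)"
proof -
  let ?d = "n\<^sup>2 - 1"
  define Ms where "Ms = (SOME Ms. onb0 n Ms)"
  have O: "onb0 n Ms" unfolding Ms_def using onb0_exists[OF n] by (rule someI_ex)
  have Amat: "A_mat n \<Phi> = mat ?d ?d (\<lambda>(i,j). Re (mtrace (\<Phi> (Ms ! i) * \<Phi> (Ms ! j))))"
    by (simp add: A_mat_def Ms_def Let_def)
  have Ac: "A_mat n \<Phi> \<in> carrier_mat ?d ?d" by (simp add: Amat)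
  note Mh = onb0_herm[OF O]
  have \<Phi>M: "\<Phi> (Ms ! i) \<in> herm k" if "i < ?d" for i using lin_map_herm[OF L Mh[OF that]] .
  have sym: "A_mat n \<Phi> $$ (i,j) = A_mat n \<Phi> $$ (j,i)" if "i < ?d" "j < ?d" for i j
    using that hvec_inner[OF \<Phi>M[OF that(1)] \<Phi>M[OF that(2)]] hvec_inner[OF \<Phi>M[OF that(2)] \<Phi>M[OF that(1)]]
    by (simp add: Amat mult.commute)
  have quad: "(\<Sum>i<?d. \<Sum>j<?d. x i * x j * A_mat n \<Phi> $$ (i,j)) \<le> lam_max (A_mat n \<Phi>) * (\<Sum>i<?d. (x i)\<^sup>2)" for x
  proof (cases "?d = 0")
    case False
    then show ?thesis using lam_max_bound[OF Ac sym] by simp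
  qed simp
  show nn: "0 \<le> lam_max (A_mat n \<Phi>)"
  proof (cases "?d = 0")
    case True
    then show ?thesis by (simp add: lam_max_def Amat)
  next
    case False
    then have d: "0 < ?d" by simp
    let ?x = "\<lambda>i::nat. if i = 0 then 1 else (0::real)"
    have "(\<Sum>i<?d. \<Sum>j<?d. ?x i * ?x j * A_mat n \<Phi> $$ (i,j)) = (\<Sum>i<?d. ?x i * (\<Sum>j<?d. ?x j * A_mat n \<Phi> $$ (i,j)))"
      by (simp only: sum_distrib_left mult.assoc)
    also have "\<dots> = A_mat n \<Phi> $$ (0,0)" by (simp only: sum_delta_mult(2)[OF d])
    also have "\<dots> = (hs_norm (\<Phi> (Ms ! 0)))\<^sup>2" using d by (simp add: Amat mtrace_square_herm[OF \<Phi>M[OF d]])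
    finally have "(hs_norm (\<Phi> (Ms ! 0)))\<^sup>2 \<le> lam_max (A_mat n \<Phi>) * (\<Sum>i<?d. (?x i)\<^sup>2)"
      using quad[of ?x] by simp
    also have "(\<Sum>i<?d. (?x i)\<^sup>2) = (\<Sum>i<?d. if i = 0 then 1 else 0)" by (intro sum.cong refl) auto
    also have "\<dots> = 1" using d by simp
    finally show ?thesis using order.trans[OF zero_le_power2] by simp
  qed
  fix X assume X: "X \<in> herm0 n"
  then have Xh: "X \<in> herm n" by (simp add: herm0_def)
  define x where "x j = Re (mtrace (X * Ms ! j))" for j
  have \<Phi>X: "\<Phi> X $$ (p,q) = (\<Sum>j<?d. complex_of_real (x j) * \<Phi> (Ms ! j) $$ (p,q))" if pq: "p < k" "q < k" for p q
  proof -
    have "\<Phi> X $$ (p,q) = (\<Sum>a<n. \<Sum>b<n. \<Sum>j<?d. complex_of_real (x j) * (Ms ! j $$ (a,b) * kern n \<Phi> a b p q))"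
      unfolding lin_map_kern[OF L Xh pq] x_def
      by (intro sum.cong refl) (simp add: onb0_expand[OF n O X] sum_distrib_right mult.assoc)
    also have "\<dots> = (\<Sum>j<?d. \<Sum>a<n. \<Sum>b<n. complex_of_real (x j) * (Ms ! j $$ (a,b) * kern n \<Phi> a b p q))"
      by (subst (2) sum.swap, subst sum.swap) (rule refl)
    also have "\<dots> = (\<Sum>j<?d. complex_of_real (x j) * \<Phi> (Ms ! j) $$ (p,q))"
      by (intro sum.cong refl) (simp add: lin_map_kern[OF L Mh pq] sum_distrib_left)
    finally show ?thesis .
  qed
  have "complex_of_real ((hs_norm (\<Phi> X))\<^sup>2) = (\<Sum>p<k. \<Sum>q<k. \<Phi> X $$ (p,q) * cnj (\<Phi> X $$ (p,q)))"
    unfolding mtrace_square_herm[OF lin_map_herm[OF L Xh], symmetric]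
    by (rule mtrace_mult_herm) (rule lin_map_herm[OF L Xh])+
  also have "\<dots> = (\<Sum>p<k. \<Sum>q<k. \<Sum>i<?d. \<Sum>j<?d. complex_of_real (x i * x j) * (\<Phi> (Ms ! i) $$ (p,q) * cnj (\<Phi> (Ms ! j) $$ (p,q))))"
    by (intro sum.cong refl) (simp add: \<Phi>X sum_product ac_simps)
  also have "\<dots> = (\<Sum>p<k. \<Sum>i<?d. \<Sum>j<?d. \<Sum>q<k. complex_of_real (x i * x j) * (\<Phi> (Ms ! i) $$ (p,q) * cnj (\<Phi> (Ms ! j) $$ (p,q))))"
    by (rule sum.cong[OF refl], subst sum.swap, rule sum.cong[OF refl], rule sum.swap)
  also have "\<dots> = (\<Sum>i<?d. \<Sum>j<?d. \<Sum>p<k. \<Sum>q<k. complex_of_real (x i * x j) * (\<Phi> (Ms ! i) $$ (p,q) * cnj (\<Phi> (Ms ! j) $$ (p,q))))"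
    by (subst sum.swap, rule sum.cong[OF refl], rule sum.swap)
  also have "\<dots> = (\<Sum>i<?d. \<Sum>j<?d. complex_of_real (x i * x j) * mtrace (\<Phi> (Ms ! i) * \<Phi> (Ms ! j)))"
    by (intro sum.cong refl) (simp add: mtrace_mult_herm[OF \<Phi>M \<Phi>M] sum_distrib_left)
  also have "Re \<dots> = (\<Sum>i<?d. \<Sum>j<?d. x i * x j * A_mat n \<Phi> $$ (i,j))"
    by (simp add: Amat)
  finally have "(hs_norm (\<Phi> X))\<^sup>2 = (\<Sum>i<?d. \<Sum>j<?d. x i * x j * A_mat n \<Phi> $$ (i,j))" by (simp only: Re_complex_of_real)
  also have "\<dots> \<le> lam_max (A_mat n \<Phi>) * (hs_norm X)\<^sup>2"
    unfolding onb0_parseval[OF n O X] x_def[symmetric] by (rule quad)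
  finally show "(hs_norm (\<Phi> X))\<^sup>2 \<le> lam_max (A_mat n \<Phi>) * (hs_norm X)\<^sup>2" .
qed

lemma hs_norm_power2:
  "X \<in> carrier_mat n n \<Longrightarrow> (hs_norm X)\<^sup>2 = (\<Sum>i<n. \<Sum>j<n. (cmod (X $$ (i,j)))\<^sup>2)"
  by (simp add: hs_norm_fnorm fnorm_power2)

lemma hs_norm_subtract_trace:
  assumes X: "X \<in> carrier_mat n n" and X0: "X0 \<in> carrier_mat n n" and n: "0 < n"
    and t: "mtrace X = complex_of_real t"
    and e: "\<And>i j. i < n \<Longrightarrow> j < n \<Longrightarrow> X0 $$ (i,j) = X $$ (i,j) - complex_of_real (if i = j then t / n else 0)"
  shows "(hs_norm X0)\<^sup>2 = (hs_norm X)\<^sup>2 - t\<^sup>2 / n"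
proof -
  let ?s = "t / n"
  have "(hs_norm X0)\<^sup>2 = (\<Sum>i<n. \<Sum>j<n. (cmod (X $$ (i,j)))\<^sup>2 - (if i = j then 2 * ?s * Re (X $$ (i,i)) - ?s\<^sup>2 else 0))"
    unfolding hs_norm_power2[OF X0]
    by (intro sum.cong refl) (auto simp: e cmod_power2 power2_diff)
  also have "\<dots> = (hs_norm X)\<^sup>2 - (2 * ?s * (\<Sum>i<n. Re (X $$ (i,i))) - n * ?s\<^sup>2)"
    unfolding hs_norm_power2[OF X] by (simp add: sum_subtractf sum_distrib_left)
  also have "(\<Sum>i<n. Re (X $$ (i,i))) = t"
    using t unfolding mtrace_carrier[OF X] by (metis Re_complex_of_real Re_sum)
  finally show ?thesis using n by (simp add: power2_eq_square field_simps)
qed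

lemma mtrace_herm_real:
  assumes X: "X \<in> herm n"
  shows "mtrace X = complex_of_real (Re (mtrace X))"
proof -
  have "Im (X $$ (i,i)) = 0" if "i < n" for i using herm_Re_Im(2)[OF X that that] by simp
  then show ?thesis by (simp add: mtrace_carrier[OF herm_carrier[OF X]] complex_eq_iff)
qed

lemma unital_bound_herm:
  assumes L: "lin_map n k \<Phi>" and U: "unital n k \<Phi>" and T: "trace_pres n \<Phi>"
    and n: "0 < n" and k: "0 < k" and X: "X \<in> herm n"
  shows "(hs_norm (\<Phi> X))\<^sup>2 \<le> (1 / k - lam_max (A_mat n \<Phi>) / n) * (Re (mtrace X))\<^sup>2 + lam_max (A_mat n \<Phi>) * (hs_norm X)\<^sup>2"
proof -
  let ?\<mu> = "lam_max (A_mat n \<Phi>)"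
  define t where "t = Re (mtrace X)"
  have t: "mtrace X = complex_of_real t" unfolding t_def by (rule mtrace_herm_real[OF X])
  let ?J = "(1 / of_nat n) \<cdot>\<^sub>m 1\<^sub>m n :: complex mat"
  have J: "?J \<in> herm n" by (intro hermI) auto
  define X0 where "X0 = complex_of_real 1 \<cdot>\<^sub>m X + complex_of_real (- t) \<cdot>\<^sub>m ?J"
  have X0h: "X0 \<in> herm n" unfolding X0_def by (rule herm_lincomb[OF X J])
  note Xc = herm_carrier[OF X] and X0c = herm_carrier[OF X0h]
  have e: "X0 $$ (i,j) = X $$ (i,j) - complex_of_real (if i = j then t / n else 0)" if "i < n" "j < n" for i j
    using that Xc by (simp add: X0_def)
  have e': "\<Phi> X0 $$ (p,q) = \<Phi> X $$ (p,q) - complex_of_real (if p = q then t / k else 0)" if "p < k" "q < k" for p q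
    using lin_map_lincomb_index[OF L X J that X0_def] U that by (simp add: unital_def)
  have "mtrace X0 = (\<Sum>i<n. X $$ (i,i) - complex_of_real (t / n))"
    unfolding mtrace_carrier[OF X0c] by (intro sum.cong refl) (simp add: e)
  also have "\<dots> = 0" using t n unfolding mtrace_carrier[OF Xc] by (simp add: sum_subtractf)
  finally have "X0 \<in> herm0 n" using X0h by (simp add: herm0_def)
  from A_mat_bound_traceless[OF L n this]
  have "(hs_norm (\<Phi> X0))\<^sup>2 \<le> ?\<mu> * (hs_norm X0)\<^sup>2" .
  moreover have "(hs_norm X0)\<^sup>2 = (hs_norm X)\<^sup>2 - t\<^sup>2 / n"
    by (rule hs_norm_subtract_trace[OF Xc X0c n t e])
  moreover have "mtrace (\<Phi> X) = complex_of_real t" using T X t by (simp add: trace_pres_def)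
  then have "(hs_norm (\<Phi> X0))\<^sup>2 = (hs_norm (\<Phi> X))\<^sup>2 - t\<^sup>2 / k"
    by (intro hs_norm_subtract_trace[OF lin_map_carrier[OF L X] lin_map_carrier[OF L X0h] k _ e'])
  ultimately have "(hs_norm (\<Phi> X))\<^sup>2 \<le> t\<^sup>2 / k + ?\<mu> * ((hs_norm X)\<^sup>2 - t\<^sup>2 / n)" by simp
  also have "\<dots> = (1 / k - ?\<mu> / n) * t\<^sup>2 + ?\<mu> * (hs_norm X)\<^sup>2" by (simp add: algebra_simps)
  finally show ?thesis unfolding t_def .
qed

lemma fnorm_complex_comb:
  assumes X: "X \<in> herm n" and Y: "Y \<in> herm n"
  shows "(fnorm {..<n} (\<lambda>p q. X $$ (p,q) + \<i> * Y $$ (p,q)))\<^sup>2 = (hs_norm X)\<^sup>2 + (hs_norm Y)\<^sup>2"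
proof -
  have "(fnorm {..<n} (\<lambda>p q. X $$ (p,q) + \<i> * Y $$ (p,q)))\<^sup>2 =
     (\<Sum>p<n. \<Sum>q<n. ((cmod (X $$ (p,q)))\<^sup>2 + (cmod (Y $$ (p,q)))\<^sup>2) + 2 * Im (X $$ (p,q) * cnj (Y $$ (p,q))))"
    unfolding fnorm_power2 cmod_power2
    by (intro sum.cong refl) (simp add: power2_eq_square algebra_simps)
  also have "\<dots> = (hs_norm X)\<^sup>2 + (hs_norm Y)\<^sup>2 + 2 * Im (mtrace (X * Y))"
    unfolding hs_norm_power2[OF herm_carrier[OF X]] hs_norm_power2[OF herm_carrier[OF Y]]
      mtrace_mult_herm[OF X Y] Im_sum sum.distrib sum_distrib_left by (rule refl)
  finally show ?thesis using Im_mtrace_mult_herm[OF X Y] by simp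
qed

lemma qbound_unital:
  assumes L: "lin_map n k \<Phi>" and U: "unital n k \<Phi>" and T: "trace_pres n \<Phi>"
    and n: "0 < n" and k: "0 < k"
  shows "qbound {..<n} {..<k} (kern n \<Phi>) (1 / k - lam_max (A_mat n \<Phi>) / n) (lam_max (A_mat n \<Phi>))"
  unfolding qbound_def
proof
  fix Y :: "nat \<Rightarrow> nat \<Rightarrow> complex"
  let ?\<mu> = "lam_max (A_mat n \<Phi>)"
  define M where "M = mat n n (\<lambda>(a,b). Y a b)"
  have M: "M \<in> carrier_mat n n" by (simp add: M_def)
  note R = hre_herm[OF M] and I = him_herm[OF M]
  have "fnorm {..<k} (\<lambda>p q. \<Sum>a<n. \<Sum>b<n. Y a b * kern n \<Phi> a b p q) =
      fnorm {..<k} (\<lambda>p q. \<Phi> (hre M) $$ (p,q) + \<i> * \<Phi> (him M) $$ (p,q))"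
  proof (rule fnorm_cong)
    fix p q assume "p \<in> {..<k}" "q \<in> {..<k}"
    then have pq: "p < k" "q < k" by auto
    have "(\<Sum>a<n. \<Sum>b<n. Y a b * kern n \<Phi> a b p q) = cext \<Phi> M $$ (p,q)"
      unfolding cext_kern[OF L M pq] by (intro sum.cong refl) (simp add: M_def)
    then show "(\<Sum>a<n. \<Sum>b<n. Y a b * kern n \<Phi> a b p q) = \<Phi> (hre M) $$ (p,q) + \<i> * \<Phi> (him M) $$ (p,q)"
      unfolding cext_index[OF L M pq] .
  qed
  then have out: "(fnorm {..<k} (\<lambda>p q. \<Sum>a<n. \<Sum>b<n. Y a b * kern n \<Phi> a b p q))\<^sup>2 =
      (hs_norm (\<Phi> (hre M)))\<^sup>2 + (hs_norm (\<Phi> (him M)))\<^sup>2"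
    using fnorm_complex_comb[OF lin_map_herm[OF L R] lin_map_herm[OF L I]] by simp
  have "fnorm {..<n} Y = fnorm {..<n} (\<lambda>p q. hre M $$ (p,q) + \<i> * him M $$ (p,q))"
    by (rule fnorm_cong) (simp add: hre_him[OF M, symmetric], simp add: M_def)
  then have inp: "(fnorm {..<n} Y)\<^sup>2 = (hs_norm (hre M))\<^sup>2 + (hs_norm (him M))\<^sup>2"
    using fnorm_complex_comb[OF R I] by simp
  have "(\<Sum>a<n. Y a a) = (\<Sum>a<n. hre M $$ (a,a) + \<i> * him M $$ (a,a))"
    by (intro sum.cong refl) (simp add: hre_him[OF M, symmetric], simp add: M_def)
  also have "\<dots> = mtrace (hre M) + \<i> * mtrace (him M)"
    by (simp add: mtrace_carrier[OF herm_carrier[OF R]] mtrace_carrier[OF herm_carrier[OF I]] sum.distrib sum_distrib_left)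
  also have "\<dots> = Complex (Re (mtrace (hre M))) (Re (mtrace (him M)))"
    using mtrace_herm_real[OF R] mtrace_herm_real[OF I] by (metis Complex_eq)
  finally have tr: "(cmod (\<Sum>a<n. Y a a))\<^sup>2 = (Re (mtrace (hre M)))\<^sup>2 + (Re (mtrace (him M)))\<^sup>2"
    by (simp add: cmod_power2)
  show "(fnorm {..<k} (\<lambda>p q. \<Sum>a<n. \<Sum>b<n. Y a b * kern n \<Phi> a b p q))\<^sup>2
      \<le> (1 / k - ?\<mu> / n) * (cmod (\<Sum>a<n. Y a a))\<^sup>2 + ?\<mu> * (fnorm {..<n} Y)\<^sup>2"
    unfolding out inp tr
    using unital_bound_herm[OF L U T n k R] unital_bound_herm[OF L U T n k I]
    by (simp only: distrib_left)
qed

lemma gamma_alt: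
  assumes "0 < n" "0 < k"
  shows "gamma n k \<Phi> = max (1 / k - lam_max (A_mat n \<Phi>) / n) 0 + lam_max (A_mat n \<Phi>)"
proof -
  let ?a = "lam_max (A_mat n \<Phi>)"
  have "real n \<ge> real k * ?a \<longleftrightarrow> 0 \<le> 1 / k - ?a / n" using assms by (simp add: field_simps)
  then show ?thesis by (simp add: gamma_def Let_def max_def algebra_simps)
qed

section \<open>Kraus operators and the main theorem\<close>

lemma lin_map_ident: "lin_map n n (\<lambda>X. X)"
  by (simp add: lin_map_def)

lemma kern_ident:
  assumes "p < n" "q < n"
  shows "kern n (\<lambda>X. X) a b p q = (if p = a \<and> q = b then 1 else 0)"
proof -
  have E: "emat n a b \<in> carrier_mat n n" by simp
  show ?thesis
    unfolding kern_def cext_index[OF lin_map_ident E assms] hre_him[OF E assms, symmetric]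
    by (simp add: emat_index assms)
qed

text \<open>Choi's theorem: complete positivity for \<open>r = n\<close>, applied to the unnormalised maximally
  entangled state, makes the Choi matrix positive; its spectral decomposition yields Kraus
  operators.\<close>

lemma cp_kraus:
  assumes c: "cp n k \<Phi>"
  shows "\<exists>r L. kraus r {..<n} {..<k} (kern n \<Phi>) L"
proof -
  define X where "X = pmat (n*n) (\<lambda>i. if i div n = i mod n then 1 else 0)"
  define C where "C = tensor_map n n n k (\<lambda>Y. Y) \<Phi> X"
  have "X \<in> psd (n*n)" unfolding X_def by (rule pmat_psd)
  then have C: "C \<in> psd (n*k)" using c unfolding cp_def C_def by blast
  then have Ch: "C \<in> herm (n*k)" by (simp add: psd_def)
  have choi: "C $$ (a*k+p, b*k+q) = kern n \<Phi> a b p q"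
    if a: "a < n" and b: "b < n" and p: "p < k" and q: "q < k" for a b p q
  proof -
    have *: "(if A div n = A mod n then 1 else (0::complex)) * (if a = A div n then 1 else 0) =
        (if A = a*n+a then 1 else 0)" if "a < n" for A a
    proof -
      have "A div n = A mod n \<and> a = A div n \<longleftrightarrow> A = a*n+a"
        using div_mod_index[OF that, of a] by (metis div_mult_mod_eq)
      then show ?thesis by auto
    qed
    have "C $$ (a*k+p, b*k+q) = (\<Sum>A<n*n. \<Sum>B<n*n. X $$ (A,B) *
        ((if a = A div n \<and> b = B div n then 1 else 0) * kern n \<Phi> (A mod n) (B mod n) p q))"
      unfolding C_def tensor_map_eq_kmap kmap_index[OF prod_index_bound[OF a p] prod_index_bound[OF b q]]
      using p q by (intro sum.cong refl) (simp add: tkern_def kern_ident[OF a b])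
    also have "\<dots> = (\<Sum>A<n*n. \<Sum>B<n*n. ((if A div n = A mod n then 1 else 0) * (if a = A div n then 1 else 0)) *
        ((if B div n = B mod n then 1 else 0) * (if b = B div n then 1 else 0)) * kern n \<Phi> (A mod n) (B mod n) p q)"
      by (intro sum.cong refl) (auto simp: X_def pmat_def)
    also have "\<dots> = (\<Sum>A<n*n. (if A = a*n+a then 1 else 0) *
        (\<Sum>B<n*n. (if B = b*n+b then 1 else 0) * kern n \<Phi> (A mod n) (B mod n) p q))"
      unfolding *[OF a] *[OF b] by (simp only: sum_distrib_left mult.assoc)
    also have "\<dots> = kern n \<Phi> a b p q"
      by (simp only: sum_delta_mult(2)[OF prod_index_bound[OF a a]] sum_delta_mult(2)[OF prod_index_bound[OF b b]]
        div_mod_index[OF a] div_mod_index[OF b])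
    finally show ?thesis .
  qed
  obtain U ev where S: "spectral_dec (n*k) C U ev" using spectral_theorem[OF Ch] .
  define L where "L i a p = complex_of_real (sqrt (ev i)) * U $$ (a*k+p, i)" for i a p
  have "kraus (n*k) {..<n} {..<k} (kern n \<Phi>) L"
    unfolding kraus_def
  proof (intro ballI)
    fix a b p q assume "a \<in> {..<n}" "b \<in> {..<n}" "p \<in> {..<k}" "q \<in> {..<k}"
    then have *: "a < n" "b < n" "p < k" "q < k" by auto
    have "kern n \<Phi> a b p q = (\<Sum>i<n*k. complex_of_real (ev i) * U $$ (a*k+p, i) * cnj (U $$ (b*k+q, i)))"
      unfolding choi[OF *, symmetric]
      by (rule spectral_dec_index[OF S prod_index_bound[OF *(1,3)] prod_index_bound[OF *(2,4)]])
    also have "\<dots> = (\<Sum>i<n*k. L i a p * cnj (L i b q))"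
    proof (rule sum.cong[OF refl])
      fix i assume "i \<in> {..<n*k}"
      then have "complex_of_real (ev i) = complex_of_real (sqrt (ev i)) * complex_of_real (sqrt (ev i))"
        using spectral_dec_psd[OF S C, of i] by (simp flip: of_real_mult)
      then show "complex_of_real (ev i) * U $$ (a*k+p, i) * cnj (U $$ (b*k+q, i)) = L i a p * cnj (L i b q)"
        unfolding L_def by (simp add: ac_simps)
    qed
    finally show "kern n \<Phi> a b p q = (\<Sum>i<n*k. L i a p * cnj (L i b q))" .
  qed
  then show ?thesis by blast
qed

lemma kraus_tensor:
  assumes L: "lin_map n k \<Phi>" "lin_map m l \<Omega>"
    and K: "kraus r {..<n} {..<k} (kern n \<Phi>) P" and G: "kraus s {..<m} {..<l} (kern m \<Omega>) Q"
  shows "kraus (r*s) {..<n*m} {..<k*l} (kern (n*m) (tensor_map n k m l \<Phi> \<Omega>))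
    (\<lambda>i A p. P (i div s) (A div m) (p div l) * Q (i mod s) (A mod m) (p mod l))"
  unfolding kraus_def
proof (intro ballI)
  fix A B p q assume "A \<in> {..<n*m}" "B \<in> {..<n*m}" "p \<in> {..<k*l}" "q \<in> {..<k*l}"
  then have *: "A < n*m" "B < n*m" "p < k*l" "q < k*l" by auto
  let ?P = "\<lambda>i A p. P i (A div m) (p div l)" and ?Q = "\<lambda>j A p. Q j (A mod m) (p mod l)"
  have "kern (n*m) (tensor_map n k m l \<Phi> \<Omega>) A B p q =
      (\<Sum>i<r. ?P i A p * cnj (?P i B q)) * (\<Sum>j<s. ?Q j A p * cnj (?Q j B q))"
    unfolding kern_tensor[OF L *] tkern_def
    using K G div_mod_bound[OF *(1)] div_mod_bound[OF *(2)] div_mod_bound[OF *(3)] div_mod_bound[OF *(4)]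
    by (simp add: kraus_def)
  also have "\<dots> = (\<Sum>i<r*s. (?P (i div s) A p * ?Q (i mod s) A p) * cnj (?P (i div s) B q * ?Q (i mod s) B q))"
    unfolding sum_product sum_nat_prod
    by (intro sum.cong refl) (simp add: ac_simps)
  finally show "kern (n*m) (tensor_map n k m l \<Phi> \<Omega>) A B p q =
    (\<Sum>i<r*s. (?P (i div s) A p * ?Q (i mod s) A p) * cnj (?P (i div s) B q * ?Q (i mod s) B q))" .
qed

lemma
  assumes pos: "0 < n" "0 < k" "0 < m"
    and L: "lin_map n k \<Phi>" and U: "unital n k \<Phi>" and T: "trace_pres n \<Phi>"
    and g: "gamma n k \<Phi> = (norm12 n \<Phi>)\<^sup>2" and L': "lin_map m l \<Omega>"
    and K: "kraus r {..<m} {..<l} (kern m \<Omega>) P"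
  shows norm12_tensor_left: "norm12 (n*m) (tensor_map n k m l \<Phi> \<Omega>) = norm12 n \<Phi> * norm12 m \<Omega>"
    and norm12_tensor_right: "norm12 (m*n) (tensor_map m l n k \<Omega> \<Phi>) = norm12 m \<Omega> * norm12 n \<Phi>"
proof -
  have N: "is_norm ({..<n} \<times> {..<m}) ({..<k} \<times> {..<l}) (tk (kern n \<Phi>) (kern m \<Omega>)) (norm12 n \<Phi> * norm12 m \<Omega>)"
  proof (rule is_norm_tensor)
    show "qbound {..<n} {..<k} (kern n \<Phi>) (1 / k - lam_max (A_mat n \<Phi>) / n) (lam_max (A_mat n \<Phi>))"
      by (rule qbound_unital[OF L U T pos(1,2)])
    show "0 \<le> lam_max (A_mat n \<Phi>)" by (rule lam_max_A_mat_nonneg[OF L pos(1)])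
    show "(norm12 n \<Phi>)\<^sup>2 = max (1 / k - lam_max (A_mat n \<Phi>) / n) 0 + lam_max (A_mat n \<Phi>)"
      unfolding g[symmetric] by (rule gamma_alt[OF pos(1,2)])
    show "is_norm {..<n} {..<k} (kern n \<Phi>) (norm12 n \<Phi>)" by (rule is_norm_norm12[OF L pos(1)])
    show "is_norm {..<m} {..<l} (kern m \<Omega>) (norm12 m \<Omega>)" by (rule is_norm_norm12[OF L' pos(3)])
  qed (use pos K in auto)
  have eq: "norm12 (n*m) (tensor_map n k m l \<Phi> \<Omega>) = N"
    if "0 < n" "0 < m" "lin_map n k \<Phi>" "lin_map m l \<Omega>"
      "is_norm ({..<n} \<times> {..<m}) ({..<k} \<times> {..<l}) (tk (kern n \<Phi>) (kern m \<Omega>)) N"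
    for n k m l \<Phi> \<Omega> N
  proof -
    have "is_norm {..<n*m} {..<k*l} (kern (n*m) (tensor_map n k m l \<Phi> \<Omega>)) N"
      by (rule is_norm_transfer[OF is_norm_tkern[OF that(5)] bij_betw_id bij_betw_id])
        (simp add: kern_tensor[OF that(3,4)])
    moreover have "is_norm {..<n*m} {..<k*l} (kern (n*m) (tensor_map n k m l \<Phi> \<Omega>))
        (norm12 (n*m) (tensor_map n k m l \<Phi> \<Omega>))"
      using that by (intro is_norm_norm12 lin_map_tensor) auto
    ultimately show ?thesis by (rule is_norm_unique[symmetric])
  qed
  show "norm12 (n*m) (tensor_map n k m l \<Phi> \<Omega>) = norm12 n \<Phi> * norm12 m \<Omega>"
    by (rule eq[OF pos(1,3) L L' N])
  show "norm12 (m*n) (tensor_map m l n k \<Omega> \<Phi>) = norm12 m \<Omega> * norm12 n \<Phi>"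
    using eq[OF pos(3,1) L' L is_norm_swap[OF N]] by (simp add: mult.commute)
qed

lemma norm12_ident_1: "norm12 1 (\<lambda>X. X) = 1"
proof (rule is_norm_unique)
  let ?A = "{..<1::nat}" and ?K = "kern 1 (\<lambda>X. X)"
  have fk: "fnorm ?A (kout ?A ?K v) = sqn ?A v" for v
  proof -
    have "(fnorm ?A (kout ?A ?K v))\<^sup>2 = (sqn ?A v)\<^sup>2"
      unfolding fnorm_power2 by (simp add: kout_def sqn_def kern_ident norm_mult power2_eq_square)
    then show ?thesis by (simp add: power2_eq_iff_nonneg)
  qed
  show "is_norm ?A ?A ?K 1"
    unfolding is_norm_def fk
  proof (intro conjI allI impI)
    fix C assume "\<forall>v. sqn ?A v \<le> C * sqn ?A v"
    from this[rule_format, of "\<lambda>_. 1"] show "1 \<le> C" by (simp add: sqn_def)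
  qed simp
  show "is_norm ?A ?A ?K (norm12 1 (\<lambda>X. X))"
    by (rule is_norm_norm12[OF lin_map_ident]) simp
qed

lemma channel_lin_map: "channel n k \<Phi> \<Longrightarrow> lin_map n k \<Phi>"
  and channel_trace_pres: "channel n k \<Phi> \<Longrightarrow> trace_pres n \<Phi>"
  and channel_cp: "channel n k \<Phi> \<Longrightarrow> cp n k \<Phi>"
  by (simp_all add: channel_def cp_def)

lemma tens_iter_channel:
  assumes "\<forall>i<N. 0 < n i \<and> 0 < k i \<and> channel (n i) (k i) (\<Phi> i) \<and> unital (n i) (k i) (\<Phi> i) \<and>
    gamma (n i) (k i) (\<Phi> i) = (norm12 (n i) (\<Phi> i))\<^sup>2"
  shows "lin_map (\<Prod>i<N. n i) (\<Prod>i<N. k i) (tens_iter n k \<Phi> N) \<and>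
    trace_pres (\<Prod>i<N. n i) (tens_iter n k \<Phi> N) \<and>
    (\<exists>r L. kraus r {..<\<Prod>i<N. n i} {..<\<Prod>i<N. k i} (kern (\<Prod>i<N. n i) (tens_iter n k \<Phi> N)) L) \<and>
    norm12 (\<Prod>i<N. n i) (tens_iter n k \<Phi> N) = (\<Prod>i<N. norm12 (n i) (\<Phi> i))"
  using assms
proof (induction N)
  case 0
  have "kraus 1 {..<1} {..<1} (kern 1 (\<lambda>X. X)) (\<lambda>_ _ _. 1)"
    by (simp add: kraus_def kern_ident)
  then have "\<exists>r L. kraus r {..<1} {..<1} (kern 1 (\<lambda>X. X)) L" by blast
  then show ?case
    using lin_map_ident norm12_ident_1 by (simp add: trace_pres_def del: One_nat_def)
next
  case (Suc N)
  let ?n = "\<Prod>i<N. n i" and ?k = "\<Prod>i<N. k i" and ?T = "tens_iter n k \<Phi> N"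
  have IH: "lin_map ?n ?k ?T" "trace_pres ?n ?T" "norm12 ?n ?T = (\<Prod>i<N. norm12 (n i) (\<Phi> i))"
    and "\<exists>r L. kraus r {..<?n} {..<?k} (kern ?n ?T) L"
    using Suc by simp_all
  then obtain r P where P: "kraus r {..<?n} {..<?k} (kern ?n ?T) P" by blast
  have h: "0 < n N" "0 < k N" "channel (n N) (k N) (\<Phi> N)" "unital (n N) (k N) (\<Phi> N)"
    "gamma (n N) (k N) (\<Phi> N) = (norm12 (n N) (\<Phi> N))\<^sup>2"
    using Suc.prems by simp_all
  note L = channel_lin_map[OF h(3)] and T = channel_trace_pres[OF h(3)]
  obtain s Q where Q: "kraus s {..<n N} {..<k N} (kern (n N) (\<Phi> N)) Q"
    using cp_kraus[OF channel_cp[OF h(3)]] by blast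
  have pos: "0 < ?n" using Suc.prems by (intro prod_pos) simp
  have step: "tens_iter n k \<Phi> (Suc N) = tensor_map ?n ?k (n N) (k N) ?T (\<Phi> N)" by simp
  have dims: "(\<Prod>i<Suc N. n i) = ?n * n N" "(\<Prod>i<Suc N. k i) = ?k * k N" by simp_all
  show ?case
    unfolding step dims
    using lin_map_tensor[OF IH(1) L] trace_pres_tensor[OF IH(1) L IH(2) T] kraus_tensor[OF IH(1) L P Q]
      norm12_tensor_right[OF h(1,2) pos L h(4) T h(5) IH(1) P] IH(3)
    by auto
qed

theorem theorem13:
  shows "(\<forall>(n::nat) (k::nat) (m::nat) (l::nat) (\<Phi>::cmap) (\<Omega>::cmap).
            0 < n \<and> 0 < k \<and> 0 < m \<and> 0 < l \<and>
            lin_map n k \<Phi> \<and> unital n k \<Phi> \<and> trace_pres n \<Phi> \<and>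
            gamma n k \<Phi> = (norm12 n \<Phi>)\<^sup>2 \<and> cp m l \<Omega> \<longrightarrow>
              norm12 (n*m) (tensor_map n k m l \<Phi> \<Omega>) = norm12 n \<Phi> * norm12 m \<Omega> \<and>
              (channel n k \<Phi> \<and> channel m l \<Omega> \<longrightarrow>
                 Smin2 (n*m) (tensor_map n k m l \<Phi> \<Omega>) = Smin2 n \<Phi> + Smin2 m \<Omega>))
       \<and> (\<forall>(N::nat) (n::nat \<Rightarrow> nat) (k::nat \<Rightarrow> nat) (\<Phi>::nat \<Rightarrow> cmap).
            (\<forall>i<N. 0 < n i \<and> 0 < k i \<and> channel (n i) (k i) (\<Phi> i) \<and>
                    unital (n i) (k i) (\<Phi> i) \<and>
                    gamma (n i) (k i) (\<Phi> i) = (norm12 (n i) (\<Phi> i))\<^sup>2) \<longrightarrow>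
              norm12 (\<Prod>i<N. n i) (tens_iter n k \<Phi> N) = (\<Prod>i<N. norm12 (n i) (\<Phi> i)) \<and>
              Smin2 (\<Prod>i<N. n i) (tens_iter n k \<Phi> N) = (\<Sum>i<N. Smin2 (n i) (\<Phi> i)))"
proof (intro conjI allI impI; (elim conjE)?)
  fix n k m l :: nat and \<Phi> \<Omega> :: cmap
  assume pos: "0 < n" "0 < k" "0 < m" and L: "lin_map n k \<Phi>" and U: "unital n k \<Phi>"
    and T: "trace_pres n \<Phi>" and g: "gamma n k \<Phi> = (norm12 n \<Phi>)\<^sup>2" and c: "cp m l \<Omega>"
  have L': "lin_map m l \<Omega>" using c by (simp add: cp_def)
  obtain r P where P: "kraus r {..<m} {..<l} (kern m \<Omega>) P" using cp_kraus[OF c] by blast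
  show N: "norm12 (n*m) (tensor_map n k m l \<Phi> \<Omega>) = norm12 n \<Phi> * norm12 m \<Omega>"
    by (rule norm12_tensor_left[OF pos L U T g L' P])
  assume "channel m l \<Omega>"
  then have T': "trace_pres m \<Omega>" by (rule channel_trace_pres)
  have "0 < n * m" using pos by simp
  then show "Smin2 (n*m) (tensor_map n k m l \<Phi> \<Omega>) = Smin2 n \<Phi> + Smin2 m \<Omega>"
    using norm12_pos[OF L T pos(1)] norm12_pos[OF L' T' pos(3)]
    by (simp add: Smin2_norm12[OF lin_map_tensor[OF L L'] trace_pres_tensor[OF L L' T T']]
      Smin2_norm12[OF L T pos(1)] Smin2_norm12[OF L' T' pos(3)] N ln_mult)
next
  fix N :: nat and n k :: "nat \<Rightarrow> nat" and \<Phi> :: "nat \<Rightarrow> cmap"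
  assume h: "\<forall>i<N. 0 < n i \<and> 0 < k i \<and> channel (n i) (k i) (\<Phi> i) \<and> unital (n i) (k i) (\<Phi> i) \<and>
    gamma (n i) (k i) (\<Phi> i) = (norm12 (n i) (\<Phi> i))\<^sup>2"
  note t = tens_iter_channel[OF h]
  then show norm: "norm12 (\<Prod>i<N. n i) (tens_iter n k \<Phi> N) = (\<Prod>i<N. norm12 (n i) (\<Phi> i))" by blast
  have pos: "0 < (\<Prod>i<N. n i)" using h by (intro prod_pos) simp
  have each: "0 < norm12 (n i) (\<Phi> i)" "Smin2 (n i) (\<Phi> i) = - 2 * ln (norm12 (n i) (\<Phi> i))" if "i < N" for i
    using that h norm12_pos Smin2_norm12 channel_lin_map channel_trace_pres by blast+
  have "Smin2 (\<Prod>i<N. n i) (tens_iter n k \<Phi> N) = - 2 * ln (\<Prod>i<N. norm12 (n i) (\<Phi> i))"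
    unfolding norm[symmetric] using t pos by (intro Smin2_norm12) auto
  also have "\<dots> = - 2 * (\<Sum>i<N. ln (norm12 (n i) (\<Phi> i)))"
    by (subst ln_prod) (auto dest: each(1))
  also have "\<dots> = (\<Sum>i<N. Smin2 (n i) (\<Phi> i))"
    unfolding sum_distrib_left by (intro sum.cong refl) (simp add: each(2))
  finally show "Smin2 (\<Prod>i<N. n i) (tens_iter n k \<Phi> N) = (\<Sum>i<N. Smin2 (n i) (\<Phi> i))" .
qed

end
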